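(* Let the autonomous single-delay equation $\dot u(t)=f\bigl(0,u(t),u(t-\tau(0,u(t)))\bigr)$ for $t\geq 0$, $u(t)=\varphi(t)$ for $t\leq 0$, satisfy the standing assumptions listed in the context (with the integer $k\geq1$ and the constants $\delta_0,L$ appearing there). For $\delta\in(0,\delta_0]$ and $x\in\mathbb{R}^d$ with $|x|=\delta$, let $E_{(k)}(\delta,x)$ be the set defined in the context, and for $\eta\in E_{(k)}(\delta,x)$ let $v(x,\eta)(\theta)$ denote the solution of the auxiliary ODE problem $$\dot v(\theta)=f\bigl(0,v(\theta),\eta(\theta)\bigr),\quad \theta\in[-\tau(0,x),0],\qquad v(-\tau(0,x))=\eta(0).$$ Suppose there exists $\delta_1\in(0,\delta_0]$ such that for all $\delta\in(0,\delta_1)$, every $x$ with $|x|=\delta$ and all $\eta\in E_{(k)}(\delta,x)$, $$\tfrac1\delta\, v(x,\eta)(0)\cdot x<\delta .$$ Then: (a) the zero solution of the delay differential equation is Lyapunov stable, and if $\delta\in(0,\delta_1)$ and $|\varphi(s)|<\delta e^{-Lkr(\delta)}$ for $s\in[-r(\delta),0]$, then the solution satisfies $|u(t)|\leq\delta$ for all $t\geq 0$; (b) the zero solution of the delay differential equation is asymptotically stable; (c) if $|\varphi(s)|<\delta_1e^{-Lkr(\delta_1)}$ for $s\in[-r(\delta_1),0]$, then $u(t)\to0$ as $t\to\infty$.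
   Context: $\mathbb{R}^d$ carries the Euclidean inner product $\cdot$ and norm $|\cdot|$; $B(0,\delta)$ is the closed ball of radius $\delta$ about $0$. The equation is autonomous: $f(t,u,v)=f(0,u,v)$ and $\tau(t,u)=\tau(0,u)$ for all $t$, and the initial time is $t_0=0$. For $\delta>0$ let $r(\delta)=\sup_{|u|\leq\delta}\tau(0,u)$. Standing assumptions. $d,k\geq 1$ are integers. (1) $(u,v)\mapsto f(0,u,v)$, $\mathbb{R}^{2d}\to\mathbb{R}^d$, and $u\mapsto\tau(0,u)$, $\mathbb{R}^d\to\mathbb{R}$, are continuous. (2) $f(0,0,0)=0$. (3) $\tau(0,0)\in(0,\infty)$. (4) There are positive constants $L_0,L_1,\delta_0$ such that $|f(0,u,v)-f(0,\tilde u,\tilde v)|\leq L_0|u-\tilde u|+L_1|v-\tilde v|$ for all $u,v,\tilde u,\tilde v\in B(0,\delta_0)$. Let $L=L_0+L_1$. (5) $\tau(0,u)$ is nonnegative and Lipschitz continuous in $u$ on $B(0,\delta_0)$. (6) $f(0,u,v)$ is at least $\max\{k-2,0\}$ times differentiable in $(u,v)$ and $\tau(0,u)$ is at least $\max\{k-1,0\}$ times differentiable in $u$. (7) Initial functions $\varphi$ belong to $C:=C([-r(\delta_0),0],\mathbb{R}^d)$, with the supremum norm. A solution is a function $u\in C^1([0,t_f),\mathbb{R}^d)$, $t_f>0$, satisfying the equation on $[0,t_f)$ with $u(0)=\varphi(0)$ (and $u=\varphi$ to the left of $0$). For $\delta\in(0,\delta_0]$ and $|x|=\delta$, $E_{(k)}(\delta,x)$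 is the set of $\eta\in C^{k-1}([-\tau(0,x),0],B(0,\delta))$ such that $x\cdot f(0,x,\eta(0))\geq0$ and, for some initial function $\varphi\in C$, the solution $u$ of the delay differential equation satisfies $\eta(\theta)=u\bigl(kr(\delta)+\theta-\tau(0,u(kr(\delta)+\theta))\bigr)$ for $\theta\in[-\tau(0,x),0]$. Lyapunov stable and asymptotically stable (Lyapunov stable, and $u(t)\to0$ for all sufficiently small initial functions) have their usual meanings.
   Formalization: In assumption (6), "times differentiable" is taken as continuously differentiable; otherwise the claim fails, e.g. d=1, k=2, f(u,v)=u with τ Lipschitz and differentiable but τ' discontinuous on a dense set: only η=0 lies in E_(2), yet 0 is unstable. *)

theory Defs
  imports "HOL-Analysis.Analysis"
begin

text \<open>
  \<open>C_on n S g\<close>: \<open>g\<close> is \<open>n\<close> times continuously differentiable on \<open>S\<close>, with derivatives taken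
  within the set (hence one-sided at the end points of an interval). The Frechet derivative \<open>D\<close>
  is of class \<open>n\<close> iff all its directional components \<open>\<lambda>x. D x h\<close> are, since the spaces are
  finite-dimensional.
\<close>

primrec C_on :: "nat \<Rightarrow> 'a::euclidean_space set \<Rightarrow> ('a \<Rightarrow> 'b::euclidean_space) \<Rightarrow> bool" where
  "C_on 0 S g \<longleftrightarrow> continuous_on S g"
| "C_on (Suc n) S g \<longleftrightarrow>
     (\<exists>D. (\<forall>x\<in>S. (g has_derivative D x) (at x within S)) \<and> (\<forall>h. C_on n S (\<lambda>x. D x h)))"

definition max_delay :: "(real ^ 'd \<Rightarrow> real) \<Rightarrow> real \<Rightarrow> real" where
  "max_delay \<tau> \<delta> = (SUP u\<in>cball 0 \<delta>. \<tau> u)"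

definition time_interval :: "ereal \<Rightarrow> real set" where
  "time_interval tf = {t. 0 \<le> t \<and> ereal t < tf}"

text \<open>
  \<open>f u v\<close> and \<open>\<tau> u\<close> stand for \<open>f(0,u,v)\<close> and \<open>\<tau>(0,u)\<close> of the autonomous equation, and \<open>R\<close> is the
  length of the history interval. A solution is carried by \<open>[-R, tf)\<close>; its values elsewhere are
  irrelevant. As \<open>\<tau>\<close> is controlled only near \<open>0\<close>, it is part of satisfying the equation that
  the deviated argument lies in \<open>[-R, tf)\<close>. The end time \<open>tf = \<infinity>\<close> is allowed.
\<close>

definition dde_solution ::
  "(real ^ 'd \<Rightarrow> real ^ 'd \<Rightarrow> real ^ 'd) \<Rightarrow> (real ^ 'd \<Rightarrow> real) \<Rightarrow> real \<Rightarrow>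
   (real \<Rightarrow> real ^ 'd) \<Rightarrow> ereal \<Rightarrow> (real \<Rightarrow> real ^ 'd) \<Rightarrow> bool" where
  "dde_solution f \<tau> R \<phi> tf u \<longleftrightarrow>
     0 < tf \<and>
     (\<forall>s\<in>{-R..0}. u s = \<phi> s) \<and>
     C_on 1 (time_interval tf) u \<and>
     (\<forall>t\<in>time_interval tf.
        t - \<tau> (u t) \<in> {-R..0} \<union> time_interval tf \<and>
        (u has_vector_derivative f (u t) (u (t - \<tau> (u t)))) (at t within time_interval tf))"

text \<open>
  For merely continuous initial functions solutions need not be unique. A claim that "the
  solution" for \<open>\<phi>\<close> exists for all \<open>t \<ge> 0\<close> and has property \<open>P\<close> means: a global solution exists,
  every solution extends to a global one, and every global solution has property \<open>P\<close>.
\<close>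

definition global_solutions_satisfy ::
  "(real ^ 'd \<Rightarrow> real ^ 'd \<Rightarrow> real ^ 'd) \<Rightarrow> (real ^ 'd \<Rightarrow> real) \<Rightarrow> real \<Rightarrow>
   (real \<Rightarrow> real ^ 'd) \<Rightarrow> ((real \<Rightarrow> real ^ 'd) \<Rightarrow> bool) \<Rightarrow> bool" where
  "global_solutions_satisfy f \<tau> R \<phi> P \<longleftrightarrow>
     (\<exists>u. dde_solution f \<tau> R \<phi> \<infinity> u) \<and>
     (\<forall>tf u. dde_solution f \<tau> R \<phi> tf u \<longrightarrow>
        (\<exists>w. dde_solution f \<tau> R \<phi> \<infinity> w \<and> (\<forall>t\<in>time_interval tf. w t = u t))) \<and>
     (\<forall>u. dde_solution f \<tau> R \<phi> \<infinity> u \<longrightarrow> P u)"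

definition lyapunov_stable ::
  "(real ^ 'd \<Rightarrow> real ^ 'd \<Rightarrow> real ^ 'd) \<Rightarrow> (real ^ 'd \<Rightarrow> real) \<Rightarrow> real \<Rightarrow> bool" where
  "lyapunov_stable f \<tau> R \<longleftrightarrow>
     (\<forall>\<epsilon>>0. \<exists>\<rho>>0. \<forall>\<phi>. continuous_on {-R..0} \<phi> \<and> (\<forall>s\<in>{-R..0}. norm (\<phi> s) < \<rho>) \<longrightarrow>
        global_solutions_satisfy f \<tau> R \<phi> (\<lambda>u. \<forall>t\<ge>0. norm (u t) < \<epsilon>))"

definition asymptotically_stable ::
  "(real ^ 'd \<Rightarrow> real ^ 'd \<Rightarrow> real ^ 'd) \<Rightarrow> (real ^ 'd \<Rightarrow> real) \<Rightarrow> real \<Rightarrow> bool" where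
  "asymptotically_stable f \<tau> R \<longleftrightarrow>
     lyapunov_stable f \<tau> R \<and>
     (\<exists>\<rho>>0. \<forall>\<phi>. continuous_on {-R..0} \<phi> \<and> (\<forall>s\<in>{-R..0}. norm (\<phi> s) < \<rho>) \<longrightarrow>
        global_solutions_satisfy f \<tau> R \<phi> (\<lambda>u. (u \<longlongrightarrow> 0) at_top))"

text \<open>
  Only the values of \<open>\<eta>\<close> on \<open>[-\<tau> x, 0]\<close> are constrained. The solution \<open>u\<close> has to reach
  beyond the time \<open>k r(\<delta>)\<close> for the defining equation of \<open>\<eta>\<close> to make sense.
\<close>

definition E_set ::
  "(real ^ 'd \<Rightarrow> real ^ 'd \<Rightarrow> real ^ 'd) \<Rightarrow> (real ^ 'd \<Rightarrow> real) \<Rightarrow> real \<Rightarrow> nat \<Rightarrow>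
   real \<Rightarrow> real ^ 'd \<Rightarrow> (real \<Rightarrow> real ^ 'd) set" where
  "E_set f \<tau> R k \<delta> x =
     {\<eta>. C_on (k - 1) {- \<tau> x..0} \<eta> \<and> \<eta> ` {- \<tau> x..0} \<subseteq> cball 0 \<delta> \<and>
          x \<bullet> f x (\<eta> 0) \<ge> 0 \<and>
          (\<exists>\<phi> tf u. continuous_on {-R..0} \<phi> \<and> dde_solution f \<tau> R \<phi> tf u \<and>
             ereal (real k * max_delay \<tau> \<delta>) < tf \<and>
             (\<forall>\<theta>\<in>{- \<tau> x..0}.
                \<eta> \<theta> = u (real k * max_delay \<tau> \<delta> + \<theta> - \<tau> (u (real k * max_delay \<tau> \<delta> + \<theta>)))))}"

definition aux_solution ::
  "(real ^ 'd \<Rightarrow> real ^ 'd \<Rightarrow> real ^ 'd) \<Rightarrow> (real ^ 'd \<Rightarrow> real) \<Rightarrow> real ^ 'd \<Rightarrow>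
   (real \<Rightarrow> real ^ 'd) \<Rightarrow> (real \<Rightarrow> real ^ 'd) \<Rightarrow> bool" where
  "aux_solution f \<tau> x \<eta> v \<longleftrightarrow>
     v (- \<tau> x) = \<eta> 0 \<and>
     (\<forall>\<theta>\<in>{- \<tau> x..0}. (v has_vector_derivative f (v \<theta>) (\<eta> \<theta>)) (at \<theta> within {- \<tau> x..0}))"

end

theory Submission
  imports Defs "HOL-Complex_Analysis.Great_Picard"
begin

text \<open>
  A solution with small initial function obeys \<open>|u t| < N * exp (L * t)\<close> with
  \<open>N = \<delta> * exp (- L * k * r \<delta>)\<close>, so it cannot reach the sphere of radius \<open>\<delta>\<close> before time \<open>k * r \<delta>\<close>.
  If it reaches that sphere later, first at time \<open>b\<close>, then its past has become smooth enough for
  \<open>\<eta> \<theta> = u (b + \<theta> - \<tau> (u (b + \<theta>)))\<close> to lie in \<open>E_set\<close>, the radial derivative at \<open>b\<close> being nonnegative,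
  and the auxiliary problem is solved by \<open>u\<close> itself. As its final value \<open>u b\<close> has norm \<open>\<delta>\<close>, this
  contradicts the criterion. Attractivity follows from the same contradiction, applied to an entire
  limit solution obtained by compactness from translates of \<open>u\<close>. Existence for merely continuous
  initial functions comes from Tonelli approximations of a truncated equation.
\<close>

subsection \<open>Calculus of \<open>C_on\<close>\<close>

text \<open>The factor \<open>exp (- L * k * r \<delta>)\<close> and the interval
  \<open>[b - k * r \<delta>, b]\<close> belong together: a solution growing at rate at most
  \<open>L\<close> from below \<open>N\<close> needs more than time \<open>k * r \<delta>\<close> to
  reach norm \<delta>, so the equation holds on the whole stretch of \<open>k\<close> delay lengths
  before \<open>b\<close>. Each delay length gains one derivative, which yields the smoothness that
  \<open>E_set\<close> demands. Two obstacles shape the rest. \<open>E_set\<close> asks for a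
  solution reaching strictly beyond time \<open>k * r \<delta>\<close>, so the orbit must be
  followed a little past \<open>b\<close>, where \<delta> no longer bounds it; the room comes from
  \<open>\<delta> < \<delta>0\<close>. And the strict inequality of the criterion has no uniform
  margin, so it gives no decay rate; a contradiction needs an orbit whose norm attains its upper
  limit, in general found only after passing to a limit. As the delay depends on the state, that
  limit is taken at moving arguments, hence the uniform equicontinuity. Solutions need not be
  unique, so it is not enough to construct one: each given partial solution has to be continued
  itself, which calls for existence from an arbitrary starting time.\<close>

lemma C_on_SucE:
  assumes "C_on (Suc n) S g"
  obtains D where "\<And>x. x \<in> S \<Longrightarrow> (g has_derivative D x) (at x within S)"
    and "\<And>h. C_on n S (\<lambda>x. D x h)"
  using assms by auto

lemma C_on_subset:
  assumes "C_on n S g" and "T \<subseteq> S"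
  shows "C_on n T g"
  using assms(1)
proof (induction n arbitrary: g)
  case 0
  then show ?case using assms(2) by (auto intro: continuous_on_subset)
next
  case (Suc n)
  obtain D where D: "\<And>x. x \<in> S \<Longrightarrow> (g has_derivative D x) (at x within S)"
    "\<And>h. C_on n S (\<lambda>x. D x h)"
    by (rule C_on_SucE[OF Suc.prems]) blast
  have "\<forall>x\<in>T. (g has_derivative D x) (at x within T)"
    using D(1) assms(2) by (meson has_derivative_subset subset_iff)
  then show ?case using Suc.IH[OF D(2)] by auto
qed

lemma C_on_SucD: "C_on (Suc n) S g \<Longrightarrow> C_on n S g"
proof (induction n arbitrary: g)
  case 0
  then show ?case
    by (auto simp: continuous_on_eq_continuous_within intro: has_derivative_continuous)
next
  case (Suc n)
  obtain D where "\<And>x. x \<in> S \<Longrightarrow> (g has_derivative D x) (at x within S)"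
    and "\<And>h. C_on (Suc n) S (\<lambda>x. D x h)"
    by (rule C_on_SucE[OF Suc.prems]) blast
  then show ?case
    by (subst C_on.simps) (intro exI[of _ D] conjI ballI allI Suc.IH)
qed

lemma C_on_antimono:
  assumes "C_on n S g" and "m \<le> n"
  shows "C_on m S g"
  using assms(2,1) by (induction rule: inc_induct) (auto dest: C_on_SucD simp del: C_on.simps)

lemma C_on_cong:
  assumes "C_on n S g" and "\<And>x. x \<in> S \<Longrightarrow> g x = g' x"
  shows "C_on n S g'"
proof (cases n)
  case 0
  then show ?thesis using assms by (auto cong: continuous_on_cong)
next
  case (Suc m)
  with assms(1) obtain D where "\<And>x. x \<in> S \<Longrightarrow> (g has_derivative D x) (at x within S)"
    "\<And>h. C_on m S (\<lambda>x. D x h)" by auto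
  then show ?thesis unfolding Suc C_on.simps
    using assms(2) by (metis has_derivative_transform)
qed

lemma C_on_const: "C_on n S (\<lambda>x. c)"
proof (induction n arbitrary: c)
  case (Suc n)
  show ?case unfolding C_on.simps
    by (rule exI[of _ "\<lambda>x h. 0"]) (auto intro: Suc)
qed simp

lemma C_on_bounded_linear:
  assumes "bounded_linear l" and "C_on n S g"
  shows "C_on n S (\<lambda>x. l (g x))"
  using assms(2)
proof (induction n arbitrary: g)
  case 0
  then show ?case by (auto intro: bounded_linear.continuous_on[OF assms(1)])
next
  case (Suc n)
  obtain D where D: "\<And>x. x \<in> S \<Longrightarrow> (g has_derivative D x) (at x within S)"
    "\<And>h. C_on n S (\<lambda>x. D x h)"
    by (rule C_on_SucE[OF Suc.prems]) blast
  show ?case unfolding C_on.simps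
    by (rule exI[of _ "\<lambda>x h. l (D x h)"])
      (auto intro: bounded_linear.has_derivative[OF assms(1)] D Suc.IH)
qed

lemma C_on_id: "C_on n S (\<lambda>x. x)"
proof (cases n)
  case (Suc m)
  show ?thesis unfolding Suc C_on.simps
    by (rule exI[of _ "\<lambda>x h. h"]) (auto intro: C_on_const)
qed (simp add: continuous_on_id)

lemma C_on_add:
  assumes "C_on n S g" and "C_on n S h"
  shows "C_on n S (\<lambda>x. g x + h x)"
  using assms
proof (induction n arbitrary: g h)
  case 0
  then show ?case by (auto intro: continuous_intros)
next
  case (Suc n)
  obtain D where D: "\<And>x. x \<in> S \<Longrightarrow> (g has_derivative D x) (at x within S)"
    "\<And>h. C_on n S (\<lambda>x. D x h)"
    by (rule C_on_SucE[OF Suc.prems(1)]) blast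
  obtain E where E: "\<And>x. x \<in> S \<Longrightarrow> (h has_derivative E x) (at x within S)"
    "\<And>h. C_on n S (\<lambda>x. E x h)"
    by (rule C_on_SucE[OF Suc.prems(2)]) blast
  show ?case unfolding C_on.simps
    by (rule exI[of _ "\<lambda>x h. D x h + E x h"]) (auto intro: has_derivative_add D E Suc.IH)
qed

lemma C_on_sum:
  assumes "finite I" and "\<And>i. i \<in> I \<Longrightarrow> C_on n S (g i)"
  shows "C_on n S (\<lambda>x. \<Sum>i\<in>I. g i x)"
  using assms by (induction I) (auto intro: C_on_const C_on_add simp del: C_on.simps)

lemma C_on_scaleR:
  assumes "C_on n S a" and "C_on n S g"
  shows "C_on n S (\<lambda>x. a x *\<^sub>R g x)"
  using assms
proof (induction n arbitrary: a g)
  case 0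
  then show ?case by (auto intro: continuous_intros)
next
  case (Suc n)
  obtain D where D: "\<And>x. x \<in> S \<Longrightarrow> (a has_derivative D x) (at x within S)"
    "\<And>h. C_on n S (\<lambda>x. D x h)"
    by (rule C_on_SucE[OF Suc.prems(1)]) blast
  obtain E where E: "\<And>x. x \<in> S \<Longrightarrow> (g has_derivative E x) (at x within S)"
    "\<And>h. C_on n S (\<lambda>x. E x h)"
    by (rule C_on_SucE[OF Suc.prems(2)]) blast
  have "C_on n S a" "C_on n S g" using Suc.prems by (auto dest: C_on_SucD simp del: C_on.simps)
  then show ?case unfolding C_on.simps
    by (intro exI[of _ "\<lambda>x h. a x *\<^sub>R E x h + D x h *\<^sub>R g x"] conjI ballI allI
        has_derivative_scaleR C_on_add Suc.IH D E)
qed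

lemma C_on_Pair:
  assumes "C_on n S g" and "C_on n S h"
  shows "C_on n S (\<lambda>x. (g x, h x))"
  using C_on_add[OF C_on_bounded_linear[OF bounded_linear_Pair[OF bounded_linear_ident bounded_linear_zero] assms(1)]
      C_on_bounded_linear[OF bounded_linear_Pair[OF bounded_linear_zero bounded_linear_ident] assms(2)]]
  by simp

text \<open>Expanding the inner derivative in an orthonormal basis turns the chain rule into a
  finite sum of products, to which the induction hypothesis applies.\<close>

lemma C_on_compose:
  assumes "C_on n T g" and "C_on n S h" and "h ` S \<subseteq> T"
  shows "C_on n S (\<lambda>x. g (h x))"
  using assms(1,2)
proof (induction n arbitrary: g)
  case 0
  then show ?case using assms(3) by (auto intro: continuous_on_compose2)
next
  case (Suc n)
  obtain D where D: "\<And>x. x \<in> T \<Longrightarrow> (g has_derivative D x) (at x within T)"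
    "\<And>h. C_on n T (\<lambda>x. D x h)"
    by (rule C_on_SucE[OF Suc.prems(1)]) blast
  obtain E where E: "\<And>x. x \<in> S \<Longrightarrow> (h has_derivative E x) (at x within S)"
    "\<And>h. C_on n S (\<lambda>x. E x h)"
    by (rule C_on_SucE[OF Suc.prems(2)]) blast
  have h: "C_on n S h" using Suc.prems by (auto dest: C_on_SucD simp del: C_on.simps)
  have 1: "((\<lambda>x. g (h x)) has_derivative (\<lambda>e. D (h x) (E x e))) (at x within S)" if "x \<in> S" for x
  proof -
    have "(g has_derivative D (h x)) (at (h x) within h ` S)"
      using D(1)[of "h x"] assms(3) that by (meson has_derivative_subset image_subset_iff)
    then show ?thesis by (rule has_derivative_in_compose[OF E(1)[OF that]])
  qed
  have 2: "C_on n S (\<lambda>x. D (h x) (E x e))" for e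
  proof (rule C_on_cong)
    show "C_on n S (\<lambda>x. \<Sum>b\<in>Basis. (E x e \<bullet> b) *\<^sub>R D (h x) b)"
      by (intro C_on_sum C_on_scaleR C_on_bounded_linear[OF bounded_linear_inner_left] E(2)
          Suc.IH D(2) h) simp
    fix x assume "x \<in> S"
    then have "linear (D (h x))" using D(1) assms(3) by (blast intro: has_derivative_linear)
    then have "D (h x) (\<Sum>b\<in>Basis. (E x e \<bullet> b) *\<^sub>R b) = (\<Sum>b\<in>Basis. (E x e \<bullet> b) *\<^sub>R D (h x) b)"
      by (simp add: linear_sum linear_cmul)
    then show "(\<Sum>b\<in>Basis. (E x e \<bullet> b) *\<^sub>R D (h x) b) = D (h x) (E x e)"
      by (simp add: euclidean_representation)
  qed
  show ?case unfolding C_on.simps using 1 2 by (intro exI[of _ "\<lambda>x e. D (h x) (E x e)"]) auto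
qed

lemma C_on_SucI_vector:
  fixes g :: "real \<Rightarrow> 'a::euclidean_space"
  assumes "\<And>t. t \<in> S \<Longrightarrow> (g has_vector_derivative g' t) (at t within S)"
    and "C_on n S g'"
  shows "C_on (Suc n) S g"
  unfolding C_on.simps
  using assms(1) C_on_scaleR[OF C_on_const assms(2)]
  by (intro exI[of _ "\<lambda>t h. h *\<^sub>R g' t"]) (auto simp: has_vector_derivative_def)

subsection \<open>Limits of equicontinuous sequences\<close>

text \<open>One \<open>d\<close> serves all indices and all points of the line. This uniformity
  allows limits at arguments that move with the index.\<close>

definition equicontinuous :: "(nat \<Rightarrow> real \<Rightarrow> 'a::real_normed_vector) \<Rightarrow> bool" where
  "equicontinuous u \<longleftrightarrow> (\<forall>e>0. \<exists>d>0. \<forall>n s t. \<bar>s - t\<bar> < d \<longrightarrow> norm (u n s - u n t) < e)"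

lemma equicontinuousD:
  assumes "equicontinuous u" and "0 < e"
  obtains d where "0 < d" and "\<And>n s t. \<bar>s - t\<bar> < d \<Longrightarrow> norm (u n s - u n t) < e"
  using assms unfolding equicontinuous_def by blast

lemma equicontinuous_continuous_on:
  assumes "equicontinuous u"
  shows "continuous_on S (u n)"
  unfolding continuous_on_iff dist_norm
  using assms unfolding equicontinuous_def by (metis real_norm_def)

lemma equicontinuous_subseq: "equicontinuous u \<Longrightarrow> equicontinuous (\<lambda>n. u (r n))"
  unfolding equicontinuous_def by meson

text \<open>Arzela-Ascoli on the whole line: a diagonal subsequence converges at all rationals, and
  equicontinuity transfers the Cauchy property from a nearby rational to every real.\<close>

lemma equicontinuous_convergent_subsequence:
  fixes u :: "nat \<Rightarrow> real \<Rightarrow> 'a::euclidean_space"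
  assumes equi: "equicontinuous u" and bound: "\<And>n t. norm (u n t) \<le> M t"
  obtains r w where "strict_mono (r :: nat \<Rightarrow> nat)" and "\<And>t. (\<lambda>n. u (r n) t) \<longlonglongrightarrow> w t"
proof -
  have Mpos: "0 < 1 + M t" for t using bound[of undefined t] norm_ge_zero[of "u undefined t"] by linarith
  \<comment> \<open>The bound \<open>M t\<close> may grow with \<open>t\<close>; rescaling by
    \<open>1 + M t > 0\<close> gives functions bounded by 1, to which the diagonal selection
    applies, and is undone pointwise afterwards.\<close>
  have "norm (u n t /\<^sub>R (1 + M t)) \<le> 1" for n t
    using bound[of n t] Mpos[of t] by (simp add: field_simps)
  then obtain r :: "nat \<Rightarrow> nat" where r: "strict_mono r"
    and lim: "\<And>q. q \<in> \<rat> \<Longrightarrow> \<exists>l. (\<lambda>n. u (r n) q /\<^sub>R (1 + M q)) \<longlonglongrightarrow> l"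
    using function_convergent_subsequence[OF countable_rat, of "\<lambda>n t. u n t /\<^sub>R (1 + M t)" 1] by blast
  have limq: "Cauchy (\<lambda>n. u (r n) q)" if q: "q \<in> \<rat>" for q
  proof -
    obtain l where "(\<lambda>n. u (r n) q /\<^sub>R (1 + M q)) \<longlonglongrightarrow> l" using lim[OF q] by blast
    then have "(\<lambda>n. (1 + M q) *\<^sub>R (u (r n) q /\<^sub>R (1 + M q))) \<longlonglongrightarrow> (1 + M q) *\<^sub>R l"
      by (intro tendsto_intros)
    then have "(\<lambda>n. u (r n) q) \<longlonglongrightarrow> (1 + M q) *\<^sub>R l"
      using Mpos[of q] by simp
    then show ?thesis by (rule LIMSEQ_imp_Cauchy)
  qed
  have "Cauchy (\<lambda>n. u (r n) t)" for t
    unfolding Cauchy_def dist_norm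
  proof (intro allI impI)
    fix e :: real assume "0 < e"
    then obtain d where d: "0 < d" "\<And>n s t. \<bar>s - t\<bar> < d \<Longrightarrow> norm (u n s - u n t) < e / 3"
      using equicontinuousD[OF equi, of "e / 3"] by auto
    obtain q where q: "q \<in> \<rat>" "t < q" "q < t + d" using Rats_dense_in_real[of t "t + d"] d by auto
    obtain N where N: "\<And>m n. m \<ge> N \<Longrightarrow> n \<ge> N \<Longrightarrow> norm (u (r m) q - u (r n) q) < e / 3"
      using limq[OF q(1)] \<open>0 < e\<close> unfolding Cauchy_def dist_norm
      by (metis divide_pos_pos zero_less_numeral)
    have "norm (u (r m) t - u (r n) t) < e" if "m \<ge> N" "n \<ge> N" for m n
    proof -
      have "norm (u (r m) t - u (r m) q) < e / 3" "norm (u (r n) q - u (r n) t) < e / 3"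
        using q by (simp_all add: d(2) del: less_divide_eq_numeral1)
      moreover have "u (r m) t - u (r n) t =
          (u (r m) t - u (r m) q) + (u (r m) q - u (r n) q) + (u (r n) q - u (r n) t)" by simp
      moreover have "norm (u (r m) t - u (r n) t) \<le> norm (u (r m) t - u (r m) q)
          + norm (u (r m) q - u (r n) q) + norm (u (r n) q - u (r n) t)"
        unfolding calculation(3) by (intro norm_triangle_le add_mono norm_triangle_ineq order_refl)
      ultimately show ?thesis using N[OF that] by linarith
    qed
    then show "\<exists>N. \<forall>m\<ge>N. \<forall>n\<ge>N. norm (u (r m) t - u (r n) t) < e" by blast
  qed
  then have "\<exists>l. (\<lambda>n. u (r n) t) \<longlonglongrightarrow> l" for t
    using Cauchy_convergent convergent_def by blast
  then obtain w where "\<And>t. (\<lambda>n. u (r n) t) \<longlonglongrightarrow> w t" by metis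
  with r show ?thesis using that by blast
qed

lemma equicontinuous_limit_continuous_on:
  assumes equi: "equicontinuous u" and lim: "\<And>t. (\<lambda>n. u n t) \<longlonglongrightarrow> w t"
  shows "continuous_on S w"
  unfolding continuous_on_iff
proof (intro ballI allI impI)
  fix t e :: real assume "0 < e"
  then obtain d where d: "0 < d" "\<And>n s t. \<bar>s - t\<bar> < d \<Longrightarrow> norm (u n s - u n t) < e / 2"
    using equicontinuousD[OF equi, of "e / 2"] by auto
  have "dist (w s) (w t) < e" if "dist s t < d" for s
  proof -
    have "(\<lambda>n. norm (u n s - u n t)) \<longlonglongrightarrow> norm (w s - w t)" by (intro tendsto_intros lim)
    moreover have "norm (u n s - u n t) \<le> e / 2" for n
      using d(2)[of s t n] that by (simp add: dist_real_def)
    ultimately have "norm (w s - w t) \<le> e / 2" by (intro LIMSEQ_le_const2) auto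
    then show ?thesis using \<open>0 < e\<close> by (simp add: dist_norm)
  qed
  then show "\<exists>d>0. \<forall>s\<in>S. dist s t < d \<longrightarrow> dist (w s) (w t) < e" using d(1) by blast
qed

text \<open>This handles the state-dependent delay: the deviated argument of the \<open>n\<close>-th
  function depends on \<open>n\<close>, so pointwise convergence alone would not identify the
  limit.\<close>

lemma equicontinuous_tendsto_compose:
  assumes equi: "equicontinuous u" and lim: "\<And>t. (\<lambda>n. u n t) \<longlonglongrightarrow> w t" and s: "s \<longlonglongrightarrow> t"
  shows "(\<lambda>n. u n (s n)) \<longlonglongrightarrow> w t"
proof -
  have "(\<lambda>n. u n (s n) - u n t) \<longlonglongrightarrow> 0"
  proof (rule LIMSEQ_I)
    fix e :: real assume "0 < e"
    then obtain d where d: "0 < d" "\<And>n s t. \<bar>s - t\<bar> < d \<Longrightarrow> norm (u n s - u n t) < e"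
      using equicontinuousD[OF equi] by metis
    obtain N where "\<And>n. n \<ge> N \<Longrightarrow> \<bar>s n - t\<bar> < d" using LIMSEQ_D[OF s d(1)] by auto
    then show "\<exists>N. \<forall>n\<ge>N. norm (u n (s n) - u n t - 0) < e" using d(2) by (metis diff_zero)
  qed
  from tendsto_add[OF this lim[of t]] show ?thesis by simp
qed

lemma has_vector_derivative_if_integral:
  fixes w :: "real \<Rightarrow> 'a::euclidean_space"
  assumes "continuous_on {a..} g" and w: "\<And>t. a \<le> t \<Longrightarrow> w t = w a + integral {a..t} g" and "a \<le> t"
  shows "(w has_vector_derivative g t) (at t within {a..})"
proof -
  \<comment> \<open>The end point \<open>t + 1\<close> makes the compact interval a neighbourhood of
    \<open>t\<close> relative to \<open>{a..}\<close>, so the derivative stays one-sided only at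
    \<open>a\<close>.\<close>
  have "continuous_on {a..t+1} g" using assms(1) by (rule continuous_on_subset) auto
  then have "((\<lambda>t. integral {a..t} g) has_vector_derivative g t) (at t within {a..t+1})"
    using assms(3) by (intro integral_has_vector_derivative) auto
  then have "((\<lambda>t. w a + integral {a..t} g) has_vector_derivative g t) (at t within {a..t+1})"
    by (auto intro!: derivative_eq_intros)
  then have "(w has_vector_derivative g t) (at t within {a..t+1})"
    by (rule has_vector_derivative_transform[rotated 2]) (use assms(3) in simp, rule w, simp)
  moreover have "at t within {a..t+1} = at t within {a..}"
    by (rule at_within_nhd[of _ "{..<t+1}"]) auto
  ultimately show ?thesis by simp
qed

subsection \<open>Global existence for bounded right-hand sides\<close>

definition dde_rhs ::
  "('a::euclidean_space \<Rightarrow> 'a \<Rightarrow> 'a) \<Rightarrow> ('a \<Rightarrow> real) \<Rightarrow> (real \<Rightarrow> 'a) \<Rightarrow> real \<Rightarrow> 'a" where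
  "dde_rhs G \<sigma> u t = G (u t) (u (t - \<sigma> (u t)))"

lemma dde_rhs_shift: "dde_rhs G \<sigma> (\<lambda>t. u (a + t)) t = dde_rhs G \<sigma> u (a + t)"
  by (simp add: dde_rhs_def add_diff_eq)

lemma continuous_on_dde_rhs:
  assumes G_cont: "continuous_on UNIV (\<lambda>(u, v). G u v)" and \<sigma>_cont: "continuous_on UNIV \<sigma>"
    and "continuous_on S u" and "T \<subseteq> S" and "\<And>t. t \<in> T \<Longrightarrow> t - \<sigma> (u t) \<in> S"
  shows "continuous_on T (dde_rhs G \<sigma> u)"
proof -
  have uT: "continuous_on T u" using assms(3,4) by (rule continuous_on_subset)
  then have "continuous_on T (\<lambda>t. t - \<sigma> (u t))"
    using uT by (intro continuous_intros continuous_on_compose2[OF \<sigma>_cont]) auto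
  then have "continuous_on T (\<lambda>t. u (t - \<sigma> (u t)))"
    using assms(5) by (intro continuous_on_compose2[OF assms(3)]) auto
  from continuous_on_compose2[OF G_cont continuous_on_Pair[OF uT this]]
  show ?thesis by (simp add: dde_rhs_def[abs_def])
qed

lemma has_vector_derivative_shift:
  assumes "(w has_vector_derivative d) (at (a + t) within (+) a ` S)"
  shows "((\<lambda>t. w (a + t)) has_vector_derivative d) (at t within S)"
proof -
  have "((+) a has_vector_derivative 1) (at t within S)"
    by (auto intro!: derivative_eq_intros)
  from vector_diff_chain_within[OF this assms] show ?thesis by (simp add: o_def)
qed

locale bounded_dde =
  fixes G :: "'a::euclidean_space \<Rightarrow> 'a \<Rightarrow> 'a" and \<sigma> :: "'a \<Rightarrow> real" and B :: real
  assumes G_cont: "continuous_on UNIV (\<lambda>(u, v). G u v)"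
    and G_bound: "\<And>u v. norm (G u v) \<le> B"
    and \<sigma>_cont: "continuous_on UNIV \<sigma>"
    and \<sigma>_nonneg: "\<And>u. 0 \<le> \<sigma> u"
begin

lemma B_nonneg: "0 \<le> B"
  using G_bound[of 0 0] norm_ge_zero[of "G 0 0"] by linarith

lemma dde_rhs_bound: "norm (dde_rhs G \<sigma> u t) \<le> B"
  by (simp add: dde_rhs_def G_bound)

lemmas dde_rhs_continuous_on = continuous_on_dde_rhs[OF G_cont \<sigma>_cont]

lemma dde_rhs_tendsto:
  assumes equi: "equicontinuous u" and lim: "\<And>t. (\<lambda>n. u n t) \<longlonglongrightarrow> w t" and "s \<longlonglongrightarrow> t"
  shows "(\<lambda>n. dde_rhs G \<sigma> (u n) (s n)) \<longlonglongrightarrow> dde_rhs G \<sigma> w t"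
proof -
  have 1: "(\<lambda>n. u n (s n)) \<longlonglongrightarrow> w t" by (rule equicontinuous_tendsto_compose[OF assms])
  have "isCont \<sigma> (w t)" using \<sigma>_cont by (simp add: continuous_on_eq_continuous_at)
  then have "(\<lambda>n. s n - \<sigma> (u n (s n))) \<longlonglongrightarrow> t - \<sigma> (w t)"
    by (intro tendsto_intros isCont_tendsto_compose[where g = \<sigma>] 1 assms(3))
  then have 2: "(\<lambda>n. u n (s n - \<sigma> (u n (s n)))) \<longlonglongrightarrow> w (t - \<sigma> (w t))"
    by (rule equicontinuous_tendsto_compose[OF equi lim])
  have "isCont (\<lambda>(u, v). G u v) (w t, w (t - \<sigma> (w t)))"
    using G_cont by (simp add: continuous_on_eq_continuous_at)
  from isCont_tendsto_compose[OF this tendsto_Pair[OF 1 2]] show ?thesis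
    by (simp add: dde_rhs_def)
qed

text \<open>The limit is taken in integrated form, where dominated convergence with the constant
  \<open>B\<close> suffices and no convergence of derivatives is needed. The shift \<open>h\<close>
  covers Tonelli's scheme, and \<open>h = 0\<close> covers translates of one solution. The identity
  is required only eventually because each approximation satisfies it only on a bounded time range
  or at late times.\<close>

lemma integral_equation_limit:
  assumes equi: "equicontinuous u" and lim: "\<And>t. (\<lambda>n. u n t) \<longlonglongrightarrow> w t" and "h \<longlonglongrightarrow> 0"
    and eq: "\<forall>\<^sub>F n in sequentially. u n b - u n a = integral {a..b} (\<lambda>s. dde_rhs G \<sigma> (u n) (s - h n))"
  shows "w b - w a = integral {a..b} (dde_rhs G \<sigma> w)"
proof -
  have "continuous_on {a..b} (\<lambda>s. dde_rhs G \<sigma> (u n) (s - h n))" for n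
    by (rule continuous_on_compose2[OF dde_rhs_continuous_on[OF equicontinuous_continuous_on[OF equi]],
          of _ UNIV]) (auto intro: continuous_intros)
  then have int: "(\<lambda>s. dde_rhs G \<sigma> (u n) (s - h n)) integrable_on {a..b}" for n
    by (rule integrable_continuous_real)
  have "(\<lambda>n. integral {a..b} (\<lambda>s. dde_rhs G \<sigma> (u n) (s - h n))) \<longlonglongrightarrow> integral {a..b} (dde_rhs G \<sigma> w)"
  proof (rule dominated_convergence(2)[where h = "\<lambda>_. B", OF int])
    fix s
    have "(\<lambda>n. s - h n) \<longlonglongrightarrow> s - 0" by (intro tendsto_intros assms(3))
    then show "(\<lambda>n. dde_rhs G \<sigma> (u n) (s - h n)) \<longlonglongrightarrow> dde_rhs G \<sigma> w s"
      using dde_rhs_tendsto[OF equi lim] by simp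
  qed (simp_all add: dde_rhs_bound integrable_const_ivl)
  moreover have "(\<lambda>n. integral {a..b} (\<lambda>s. dde_rhs G \<sigma> (u n) (s - h n))) \<longlonglongrightarrow> w b - w a"
    using eq by (rule Lim_transform_eventually[rotated]) (intro tendsto_intros lim)
  ultimately show ?thesis using LIMSEQ_unique by blast
qed

text \<open>Tonelli's scheme: the equation with its right-hand side delayed by \<open>h\<close> is solved by
  \<open>m\<close> iterations up to time \<open>m * h\<close>.\<close>

primrec tonelli :: "(real \<Rightarrow> 'a) \<Rightarrow> real \<Rightarrow> nat \<Rightarrow> real \<Rightarrow> 'a" where
  "tonelli p h 0 t = p t"
| "tonelli p h (Suc m) t = p t + integral {0..t} (\<lambda>s. dde_rhs G \<sigma> (tonelli p h m) (s - h))"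

text \<open>Negative \<open>s\<close> and \<open>t\<close> are included: the integral over the empty
  interval is 0. Thus a single formula describes the Tonelli iterates on both sides of 0.\<close>

lemma norm_integral_diff_le:
  assumes g: "continuous_on UNIV g" and B: "\<And>s. norm (g s :: 'a) \<le> B"
  shows "norm (integral {0..s} g - integral {0..t} g) \<le> B * \<bar>s - t\<bar>"
proof -
  have *: "norm (integral {0..t} g - integral {0..s} g) \<le> B * (t - s)" if "s \<le> t" for s t
  proof (cases "0 \<le> s")
    case True
    have "g integrable_on {0..t}" using g by (intro integrable_continuous_real) (auto intro: continuous_on_subset)
    then have "integral {0..t} g - integral {0..s} g = integral {s..t} g"
      using Henstock_Kurzweil_Integration.integral_combine[OF True that, of g] by (simp add: algebra_simps)
    then show ?thesis using integral_bound[OF that, of g B] B g by (auto intro: continuous_on_subset)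
  next
    case False
    then have s: "integral {0..s} g = 0" by simp
    show ?thesis
    proof (cases "0 \<le> t")
      case True
      have "norm (integral {0..t} g) \<le> B * (t - 0)"
        using integral_bound[OF True, of g B] B g by (auto intro: continuous_on_subset)
      also have "\<dots> \<le> B * (t - s)" using False B_nonneg by (intro mult_left_mono) auto
      finally show ?thesis using s by simp
    next
      case False
      then show ?thesis using s that B_nonneg by simp
    qed
  qed
  show ?thesis using *[of s t] *[of t s] by (cases "s \<le> t") (auto simp: norm_minus_commute)
qed

text \<open>The modulus of continuity depends neither on \<open>h\<close> nor on \<open>m\<close>,
  which gives equicontinuity of the whole scheme. Continuity goes by induction through the same
  bound, since bounding the iterate \<open>Suc m\<close> requires a continuous integrand built from
  iterate \<open>m\<close>.\<close>

lemma tonelli_estimate: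
  assumes p: "continuous_on UNIV p"
  shows "continuous_on UNIV (tonelli p h m)"
    and "norm (tonelli p h m s - tonelli p h m t) \<le> norm (p s - p t) + B * \<bar>s - t\<bar>"
proof -
  have *: "continuous_on UNIV (\<lambda>s. dde_rhs G \<sigma> u (s - h))" if "continuous_on UNIV u" for u
    by (rule continuous_on_compose2[OF dde_rhs_continuous_on[OF that], of UNIV])
      (auto intro: continuous_intros)
  have bound: "norm (tonelli p h (Suc m) s - tonelli p h (Suc m) t) \<le> norm (p s - p t) + B * \<bar>s - t\<bar>"
    if "continuous_on UNIV (tonelli p h m)" for m s t
  proof -
    let ?I = "\<lambda>t. integral {0..t} (\<lambda>s. dde_rhs G \<sigma> (tonelli p h m) (s - h))"
    have "norm (?I s - ?I t) \<le> B * \<bar>s - t\<bar>"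
      by (rule norm_integral_diff_le[OF *[OF that] dde_rhs_bound])
    moreover have "tonelli p h (Suc m) s - tonelli p h (Suc m) t = (p s - p t) + (?I s - ?I t)" by simp
    then have "norm (tonelli p h (Suc m) s - tonelli p h (Suc m) t) \<le> norm (p s - p t) + norm (?I s - ?I t)"
      by (simp only: norm_triangle_ineq)
    ultimately show ?thesis by (simp only: order_trans[OF _ add_left_mono])
  qed
  show cont: "continuous_on UNIV (tonelli p h m)" for m
  proof (induction m)
    case (Suc m)
    show ?case unfolding continuous_on_def
    proof
      fix t
      have "isCont p t" using p by (simp add: continuous_on_eq_continuous_at)
      then have "isCont (\<lambda>s. norm (p s - p t) + B * \<bar>s - t\<bar>) t"
        by (intro continuous_intros)
      then have "((\<lambda>s. norm (p s - p t) + B * \<bar>s - t\<bar>) \<longlongrightarrow> norm (p t - p t) + B * \<bar>t - t\<bar>) (at t)"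
        by (simp only: isCont_def)
      then have "((\<lambda>s. norm (p s - p t) + B * \<bar>s - t\<bar>) \<longlongrightarrow> 0) (at t)" by simp
      then have "((\<lambda>s. tonelli p h (Suc m) s - tonelli p h (Suc m) t) \<longlongrightarrow> 0) (at t)"
        by (rule Lim_null_comparison[rotated]) (intro always_eventually allI bound[OF Suc])
      then show "(tonelli p h (Suc m) \<longlongrightarrow> tonelli p h (Suc m) t) (at t)"
        by (simp only: LIM_zero_iff)
    qed
  qed (simp add: p eta_contract_eq)
  show "norm (tonelli p h m s - tonelli p h m t) \<le> norm (p s - p t) + B * \<bar>s - t\<bar>"
  proof (cases m)
    case 0
    then show ?thesis using B_nonneg by simp
  next
    case (Suc n)
    show ?thesis unfolding Suc by (rule bound[OF cont])
  qed
qed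

text \<open>As \<sigma> is nonnegative, the integrand at time \<open>s\<close> looks only at values
  up to \<open>s - h\<close>. Agreement of two successive iterates up to \<open>m * h\<close>
  therefore forces agreement of the next two up to \<open>(m + 1) * h\<close>; at nonpositive times
  the integrals vanish.\<close>

lemma tonelli_stationary:
  assumes "0 \<le> h"
  shows "t \<le> real m * h \<Longrightarrow> tonelli p h (Suc m) t = tonelli p h m t"
proof (induction m arbitrary: t)
  case 0
  then show ?case using \<sigma>_nonneg by (cases "t = 0") auto
next
  case (Suc m)
  have "dde_rhs G \<sigma> (tonelli p h (Suc m)) (s - h) = dde_rhs G \<sigma> (tonelli p h m) (s - h)"
    if "s \<in> {0..t}" for s
  proof -
    have le: "s - h \<le> real m * h" using that Suc.prems by (auto simp: algebra_simps)
    have "s - h - \<sigma> x \<le> real m * h" for x using le \<sigma>_nonneg[of x] by linarith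
    then show ?thesis unfolding dde_rhs_def using Suc.IH le by presburger
  qed
  then have "integral {0..t} (\<lambda>s. dde_rhs G \<sigma> (tonelli p h (Suc m)) (s - h)) =
      integral {0..t} (\<lambda>s. dde_rhs G \<sigma> (tonelli p h m) (s - h))"
    by (rule integral_cong)
  then show ?case by (simp only: tonelli.simps)
qed

text \<open>Boundedness of \<open>G\<close> excludes blow-up, and uniform continuity of \<phi> on
  the half-line makes the approximations equicontinuous on the whole line. The solution is a limit
  point of the scheme, with no claim of uniqueness.\<close>

lemma ex_global_solution_0:
  assumes \<phi>: "uniformly_continuous_on {..0} \<phi>"
  obtains w where "continuous_on UNIV w" and "\<And>t. t \<le> 0 \<Longrightarrow> w t = \<phi> t"
    and "\<And>t. 0 \<le> t \<Longrightarrow> (w has_vector_derivative dde_rhs G \<sigma> w t) (at t within {0..})"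
proof -
  define p where "p t = \<phi> (min t 0)" for t
  have p: "\<exists>d>0. \<forall>s t. \<bar>s - t\<bar> < d \<longrightarrow> norm (p s - p t) < e" if e: "0 < e" for e
  proof -
    obtain d where d: "0 < d" "\<forall>s\<in>{..0}. \<forall>t\<in>{..0}. dist t s < d \<longrightarrow> dist (\<phi> t) (\<phi> s) < e"
      using \<phi>[unfolded uniformly_continuous_on_def, rule_format, OF e] by blast
    have "norm (p s - p t) < e" if "\<bar>s - t\<bar> < d" for s t
      using d(2)[rule_format, of "min t 0" "min s 0"] that
      by (auto simp: p_def dist_norm min_def split: if_splits)
    then show ?thesis using d(1) by blast
  qed
  have p_cont: "continuous_on UNIV p"
    unfolding continuous_on_iff dist_norm using p by (metis real_norm_def)
  define h where "h n = 1 / real (Suc n)" for n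
  \<comment> \<open>\<open>(n + 1)^2\<close> steps of length \<open>1 / (n + 1)\<close> reach time
    \<open>n + 1\<close>, so every fixed time is eventually covered while the step length tends to
    0.\<close>
  define u where "u n = tonelli p (h n) (Suc n * Suc n)" for n
  have h0: "h \<longlonglongrightarrow> 0" unfolding h_def using LIMSEQ_inverse_real_of_nat by (simp add: inverse_eq_divide)
  have u_diff: "norm (u n s - u n t) \<le> norm (p s - p t) + B * \<bar>s - t\<bar>" for n s t
    unfolding u_def by (rule tonelli_estimate[OF p_cont])
  have u_left: "u n t = \<phi> t" if "t \<le> 0" for n t
    using that by (cases "t = 0") (auto simp: u_def p_def)
  have equi: "equicontinuous u"
    unfolding equicontinuous_def
  proof (intro allI impI)
    fix e :: real assume e: "0 < e"
    then obtain d where d: "0 < d" "\<And>s t. \<bar>s - t\<bar> < d \<Longrightarrow> norm (p s - p t) < e / 2"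
      using p[of "e / 2"] by auto
    have "norm (u n s - u n t) < e" if "\<bar>s - t\<bar> < min d (e / (2 * (B + 1)))" for n s t
    proof -
      have "\<bar>s - t\<bar> \<le> e / (2 * (B + 1))" using that by simp
      then have "(B + 1) * \<bar>s - t\<bar> \<le> e / 2" using B_nonneg by (simp add: field_simps)
      then have "B * \<bar>s - t\<bar> \<le> e / 2"
        by (rule order_trans[rotated]) (simp add: distrib_right)
      then show ?thesis using d(2)[of s t] that u_diff[of n s t] by simp
    qed
    moreover have "min d (e / (2 * (B + 1))) > 0" using d(1) e B_nonneg by simp
    ultimately show "\<exists>d>0. \<forall>n s t. \<bar>s - t\<bar> < d \<longrightarrow> norm (u n s - u n t) < e" by blast
  qed
  have "norm (u n t) \<le> norm (\<phi> 0) + (norm (p t - p 0) + B * \<bar>t\<bar>)" for n t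
    using u_diff[of n t 0] u_left[of 0 n] norm_triangle_ineq[of "\<phi> 0" "u n t - \<phi> 0"] by simp
  from equicontinuous_convergent_subsequence[OF equi this]
  obtain r w where r: "strict_mono (r :: nat \<Rightarrow> nat)" and lim: "\<And>t. (\<lambda>n. u (r n) t) \<longlonglongrightarrow> w t"
    by blast
  have equi': "equicontinuous (\<lambda>n. u (r n))" by (rule equicontinuous_subseq[OF equi])
  have w_cont: "continuous_on UNIV w"
    by (rule equicontinuous_limit_continuous_on[OF equi' lim])
  have w_left: "w t = \<phi> t" if "t \<le> 0" for t
    using lim[of t] u_left[OF that] by (simp add: LIMSEQ_const_iff)
  have w_eq: "w t - w 0 = integral {0..t} (dde_rhs G \<sigma> w)" if "0 \<le> t" for t
  proof (rule integral_equation_limit[OF equi' lim])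
    show "(\<lambda>n. h (r n)) \<longlonglongrightarrow> 0" using LIMSEQ_subseq_LIMSEQ[OF h0 r] by (simp add: o_def)
    have "u n t - u n 0 = integral {0..t} (\<lambda>s. dde_rhs G \<sigma> (u n) (s - h n))" if n: "t \<le> real n" for n
    proof -
      have "real (Suc n * Suc n) * h n = real (Suc n)"
        by (simp only: h_def of_nat_mult) simp
      then have "t \<le> real (Suc n * Suc n) * h n" using n by simp
      then have "u n t = tonelli p (h n) (Suc (Suc n * Suc n)) t"
        unfolding u_def by (rule tonelli_stationary[symmetric, rotated]) (simp add: h_def)
      also have "\<dots> = p t + integral {0..t} (\<lambda>s. dde_rhs G \<sigma> (u n) (s - h n))"
        unfolding u_def by (simp only: tonelli.simps)
      also have "p t = u n 0" using \<open>0 \<le> t\<close> u_left[of 0 n] by (simp add: p_def)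
      finally show ?thesis by simp
    qed
    moreover have "\<forall>\<^sub>F n in sequentially. t \<le> real (r n)"
      using filterlim_compose[OF filterlim_real_sequentially filterlim_subseq[OF r]]
      by (simp add: filterlim_at_top)
    ultimately show "\<forall>\<^sub>F n in sequentially. u (r n) t - u (r n) 0 =
        integral {0..t} (\<lambda>s. dde_rhs G \<sigma> (u (r n)) (s - h (r n)))"
      by (auto elim: eventually_mono)
  qed
  have "(w has_vector_derivative dde_rhs G \<sigma> w t) (at t within {0..})" if "0 \<le> t" for t
  proof (rule has_vector_derivative_if_integral[OF _ _ that])
    show "continuous_on {0..} (dde_rhs G \<sigma> w)" by (rule dde_rhs_continuous_on[OF w_cont]) auto
    show "w t = w 0 + integral {0..t} (dde_rhs G \<sigma> w)" if "0 \<le> t" for t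
      by (simp flip: w_eq[OF that])
  qed
  with w_cont w_left show ?thesis using that by blast
qed

lemma ex_global_solution:
  assumes \<phi>: "uniformly_continuous_on {..a} \<phi>"
  obtains w where "continuous_on UNIV w" and "\<And>t. t \<le> a \<Longrightarrow> w t = \<phi> t"
    and "\<And>t. a \<le> t \<Longrightarrow> (w has_vector_derivative dde_rhs G \<sigma> w t) (at t within {a..})"
proof -
  have "uniformly_continuous_on {..0} (\<lambda>t. \<phi> (a + t))"
    using \<phi> unfolding uniformly_continuous_on_def
    by (metis add_le_cancel_left add.right_neutral atMost_iff dist_add_cancel)
  then obtain w where w: "continuous_on UNIV w" "\<And>t. t \<le> 0 \<Longrightarrow> w t = \<phi> (a + t)"
    "\<And>t. 0 \<le> t \<Longrightarrow> (w has_vector_derivative dde_rhs G \<sigma> w t) (at t within {0..})"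
    using ex_global_solution_0 by blast
  show ?thesis
  proof
    show "continuous_on UNIV (\<lambda>t. w (t - a))"
      by (rule continuous_on_compose2[OF w(1)]) (auto intro: continuous_intros)
    show "w (t - a) = \<phi> t" if "t \<le> a" for t using w(2)[of "t - a"] that by simp
    show "((\<lambda>t. w (t - a)) has_vector_derivative dde_rhs G \<sigma> (\<lambda>t. w (t - a)) t) (at t within {a..})"
      if "a \<le> t" for t
    proof -
      have "(+) (- a) ` {a..} = {0..}" by (simp only: image_add_atLeast) simp
      then have "((\<lambda>t. w (- a + t)) has_vector_derivative dde_rhs G \<sigma> w (- a + t)) (at t within {a..})"
        using that by (intro has_vector_derivative_shift) (simp only: w(3))
      then show ?thesis using dde_rhs_shift[of G \<sigma> w "- a" t] by simp
    qed
  qed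
qed

end

subsection \<open>The critical point argument\<close>

lemma time_interval_ereal: "time_interval (ereal c) = {0..<c}"
  by (auto simp: time_interval_def)

lemma time_interval_PInf: "time_interval \<infinity> = {0..}"
  by (auto simp: time_interval_def)

text \<open>The squared norm has derivative \<open>2 * (w b \<bullet> d)\<close> at
  \<open>b\<close>; were it negative, the norm would be larger just before \<open>b\<close>. This
  supplies the sign condition in \<open>E_set\<close>.\<close>

lemma inner_derivative_nonneg_at_max_norm:
  fixes w :: "real \<Rightarrow> 'a::euclidean_space"
  assumes w: "(w has_vector_derivative d) (at b within {a..b})" and "a < b"
    and max: "\<And>t. t \<in> {a..b} \<Longrightarrow> norm (w t) \<le> norm (w b)"
  shows "0 \<le> w b \<bullet> d"
proof (rule ccontr)
  assume neg: "\<not> 0 \<le> w b \<bullet> d"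
  have "((\<lambda>t. w t \<bullet> w t) has_derivative (\<lambda>h. w b \<bullet> h *\<^sub>R d + h *\<^sub>R d \<bullet> w b)) (at b within {a..b})"
    using w unfolding has_vector_derivative_def by (intro has_derivative_inner)
  then have "((\<lambda>t. w t \<bullet> w t) has_real_derivative 2 * (w b \<bullet> d)) (at b within {a..b})"
    unfolding has_field_derivative_def
    by (rule has_derivative_eq_rhs) (auto simp: fun_eq_iff inner_commute)
  moreover have "2 * (w b \<bullet> d) < 0" using neg by simp
  ultimately obtain e where e: "0 < e"
    "\<forall>h>0. b - h \<in> {a..b} \<longrightarrow> h < e \<longrightarrow> w b \<bullet> w b < w (b - h) \<bullet> w (b - h)"
    using has_real_derivative_neg_dec_left by blast
  define h where "h = min (e / 2) (b - a)"
  have h: "0 < h" "h < e" "b - h \<in> {a..b}" using e(1) \<open>a < b\<close> by (auto simp: h_def min_def field_simps)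
  have "w b \<bullet> w b < w (b - h) \<bullet> w (b - h)" using e(2) h by blast
  then show False using max[OF h(3)] by (simp add: dot_square_norm power_mono leD)
qed

locale state_dependent_dde =
  fixes f :: "real ^ 'd \<Rightarrow> real ^ 'd \<Rightarrow> real ^ 'd" and \<tau> :: "real ^ 'd \<Rightarrow> real"
    and L0 L1 L \<delta>0 :: real
  assumes f_cont: "continuous_on UNIV (\<lambda>(u, v). f u v)"
    and tau_cont: "continuous_on UNIV \<tau>"
    and f_zero: "f 0 0 = 0"
    and tau_zero: "\<tau> 0 > 0"
    and const_pos: "L0 > 0" "L1 > 0" "\<delta>0 > 0"
    and f_lipschitz:
      "\<forall>u\<in>cball 0 \<delta>0. \<forall>v\<in>cball 0 \<delta>0. \<forall>u'\<in>cball 0 \<delta>0. \<forall>v'\<in>cball 0 \<delta>0.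
         norm (f u v - f u' v') \<le> L0 * norm (u - u') + L1 * norm (v - v')"
    and L: "L = L0 + L1"
    and tau_nonneg: "\<forall>u\<in>cball 0 \<delta>0. \<tau> u \<ge> 0"
begin

abbreviation r :: "real \<Rightarrow> real" where "r \<equiv> max_delay \<tau>"

abbreviation R :: real where "R \<equiv> max_delay \<tau> \<delta>0"

lemma L_pos: "0 < L"
  using const_pos L by simp

lemma tau_bdd: "bdd_above (\<tau> ` cball 0 \<delta>)"
  by (intro bounded_imp_bdd_above compact_imp_bounded compact_continuous_image compact_cball
      continuous_on_subset[OF tau_cont]) auto

lemma tau_le_max_delay: "norm u \<le> \<delta> \<Longrightarrow> \<tau> u \<le> r \<delta>"
  unfolding max_delay_def by (rule cSUP_upper[OF _ tau_bdd]) simp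

lemma max_delay_pos: "0 \<le> \<delta> \<Longrightarrow> 0 < r \<delta>"
  using tau_le_max_delay[of 0 \<delta>] tau_zero by simp

lemma max_delay_mono: "0 \<le> \<delta> \<Longrightarrow> \<delta> \<le> \<delta>' \<Longrightarrow> r \<delta> \<le> r \<delta>'"
  unfolding max_delay_def by (rule cSUP_subset_mono[OF _ tau_bdd]) auto

lemma tau_ge_0: "norm u \<le> \<delta>0 \<Longrightarrow> 0 \<le> \<tau> u"
  using tau_nonneg by simp

lemma f_bound: "norm u \<le> \<delta>0 \<Longrightarrow> norm v \<le> \<delta>0 \<Longrightarrow> norm (f u v) \<le> L0 * norm u + L1 * norm v"
  using f_lipschitz[rule_format, of u v 0 0] f_zero const_pos by simp

text \<open>Smoothing by steps: for \<open>t\<close> beyond \<open>a + m * \<rho>\<close> the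
  deviated argument stays in the interval where \<open>w\<close> is already of class
  \<open>m\<close>, so the right-hand side is of class \<open>m\<close> and \<open>w\<close> of
  class \<open>m + 1\<close>. The offset \<open>m - 1\<close> puts the history
  \<open>[a - \<rho>, a]\<close>, which is merely continuous, at level 0.\<close>

lemma C_on_orbit:
  assumes f_smooth: "C_on (k - 2) UNIV (\<lambda>(u, v). f u v)"
    and tau_smooth: "C_on (k - 1) UNIV \<tau>"
    and cont: "continuous_on {a - \<rho>..b} w"
    and eq: "\<And>t. t \<in> {a..b} \<Longrightarrow> (w has_vector_derivative dde_rhs f \<tau> w t) (at t within {a..b})"
    and delay: "\<And>t. t \<in> {a..b} \<Longrightarrow> \<tau> (w t) \<in> {0..\<rho>}" and "0 \<le> \<rho>"
  shows "m \<le> k - 1 \<Longrightarrow> C_on m {a + (real m - 1) * \<rho>..b} w"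
proof (induction m)
  case 0
  then show ?case using cont by simp
next
  case (Suc m)
  let ?S = "{a + real m * \<rho>..b}"
  have sub: "?S \<subseteq> {a..b}" using \<open>0 \<le> \<rho>\<close> by (auto intro: order_trans[rotated])
  have IH: "C_on m {a + (real m - 1) * \<rho>..b} w" using Suc by simp
  have w: "C_on m ?S w" by (rule C_on_subset[OF IH]) (use \<open>0 \<le> \<rho>\<close> in \<open>auto simp: algebra_simps\<close>)
  have "C_on m UNIV \<tau>" by (rule C_on_antimono[OF tau_smooth]) (use Suc.prems in simp)
  then have "C_on m ?S (\<lambda>t. \<tau> (w t))" by (rule C_on_compose[OF _ w]) simp
  then have "C_on m ?S (\<lambda>t. t + - \<tau> (w t))"
    by (intro C_on_add C_on_id C_on_bounded_linear[OF bounded_linear_minus[OF bounded_linear_ident]])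
  then have "C_on m ?S (\<lambda>t. w (t + - \<tau> (w t)))"
  proof (rule C_on_compose[OF IH])
    have "t + - \<tau> (w t) \<in> {a + (real m - 1) * \<rho>..b}" if "t \<in> ?S" for t
    proof -
      have "t \<in> {a..b}" using sub that by blast
      from delay[OF this] this that show ?thesis by (simp add: left_diff_distrib)
    qed
    then show "(\<lambda>t. t + - \<tau> (w t)) ` ?S \<subseteq> {a + (real m - 1) * \<rho>..b}" by blast
  qed
  then have pair: "C_on m ?S (\<lambda>t. (w t, w (t + - \<tau> (w t))))" by (rule C_on_Pair[OF w])
  have "C_on m UNIV (\<lambda>(u, v). f u v)"
    by (rule C_on_antimono[OF f_smooth]) (use Suc.prems in simp)
  from C_on_compose[OF this pair]
  have "C_on m ?S (\<lambda>t. (\<lambda>(u, v). f u v) (w t, w (t + - \<tau> (w t))))" by blast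
  then have "C_on m ?S (dde_rhs f \<tau> w)" by (simp add: dde_rhs_def[abs_def])
  then have "C_on (Suc m) ?S w"
    by (rule C_on_SucI_vector[rotated]) (use eq sub in \<open>blast intro: has_vector_derivative_within_subset\<close>)
  then show ?case by simp
qed

text \<open>The roles of the bounds differ: \<delta> on \<open>[a - r \<delta>, b]\<close> keeps the
  delays below \<open>r \<delta>\<close> and puts \<eta> into the ball, whereas \<delta>0 on
  \<open>[a, c)\<close> only keeps deviated arguments at or after \<open>a - R\<close>, so that the
  orbit is a solution in the sense of \<open>dde_solution\<close> up to some
  \<open>c > b\<close>.\<close>

lemma no_critical_orbit:
  assumes "k \<ge> 1"
    and f_smooth: "C_on (k - 2) UNIV (\<lambda>(u, v). f u v)"
    and tau_smooth: "C_on (k - 1) UNIV \<tau>"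
    and \<delta>: "0 < \<delta>" "\<delta> \<le> \<delta>0"
    and criterion: "\<And>x \<eta> v. norm x = \<delta> \<Longrightarrow> \<eta> \<in> E_set f \<tau> R k \<delta> x \<Longrightarrow> aux_solution f \<tau> x \<eta> v \<Longrightarrow>
      1 / \<delta> * (v 0 \<bullet> x) < \<delta>"
    and a: "a = b - real k * r \<delta>" and "b < c"
    and cont: "continuous_on {a - R..<c} w"
    and eq: "\<And>t. t \<in> {a..<c} \<Longrightarrow> (w has_vector_derivative dde_rhs f \<tau> w t) (at t within {a..<c})"
    and small: "\<And>t. t \<in> {a - r \<delta>..b} \<Longrightarrow> norm (w t) \<le> \<delta>"
    and small0: "\<And>t. t \<in> {a..<c} \<Longrightarrow> norm (w t) \<le> \<delta>0"
  shows "norm (w b) \<noteq> \<delta>"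
proof
  assume x: "norm (w b) = \<delta>"
  have r: "0 < r \<delta>" "r \<delta> \<le> R" using \<delta> by (auto intro: max_delay_pos max_delay_mono)
  have kr: "r \<delta> \<le> real k * r \<delta>" using \<open>k \<ge> 1\<close> r by simp
  have ab: "a < b" using r kr a by simp
  have delay: "\<tau> (w t) \<in> {0..r \<delta>}" if "t \<in> {a..b}" for t
    using small[of t] that r \<delta> by (auto intro!: tau_ge_0 tau_le_max_delay)
  have delay0: "\<tau> (w t) \<in> {0..R}" if "t \<in> {a..<c}" for t
    using small0[of t] that by (auto intro!: tau_ge_0 tau_le_max_delay)
  \<comment> \<open>The equation being autonomous, translation by \<open>a\<close> is harmless and
    moves \<open>b\<close> to time \<open>k * r \<delta>\<close>. The same \<open>u\<close> serves
    as initial function on \<open>[-R, 0]\<close> and as solution.\<close>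
  define u where "u = (\<lambda>s. w (a + s))"
  define \<eta> where "\<eta> = (\<lambda>\<theta>. w (b + \<theta> - \<tau> (w (b + \<theta>))))"
  let ?c = "c - a"
  have shift: "(+) a ` {0..<?c} = {a..<c}" by simp
  have u_eq: "(u has_vector_derivative dde_rhs f \<tau> u t) (at t within {0..<?c})" if "t \<in> {0..<?c}" for t
    unfolding u_def dde_rhs_shift
    by (rule has_vector_derivative_shift, unfold shift) (rule eq, use that in auto)
  have "continuous_on {0..<?c} (\<lambda>t. dde_rhs f \<tau> w (a + t))"
  proof (rule continuous_on_compose2[OF continuous_on_dde_rhs[OF f_cont tau_cont cont, of "{a..<c}"]])
    show "t - \<tau> (w t) \<in> {a - R..<c}" if "t \<in> {a..<c}" for t
      using delay0[OF that] that by auto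
  qed (use r in \<open>auto intro!: continuous_intros\<close>)
  then have "continuous_on {0..<?c} (dde_rhs f \<tau> u)"
    by (simp add: u_def dde_rhs_shift[abs_def])
  then have u_C: "C_on 1 {0..<?c} u"
    using C_on_SucI_vector[of "{0..<?c}" u "dde_rhs f \<tau> u" 0] u_eq by simp
  have u_sol: "dde_solution f \<tau> R u (ereal ?c) u"
    unfolding dde_solution_def time_interval_ereal
  proof (intro conjI ballI)
    show "0 < ereal ?c" using ab \<open>b < c\<close> by simp
    fix t assume t: "t \<in> {0..<?c}"
    then show "t - \<tau> (u t) \<in> {- R..0} \<union> {0..<?c}"
      using delay0[of "a + t"] by (auto simp: u_def)
    show "(u has_vector_derivative f (u t) (u (t - \<tau> (u t)))) (at t within {0..<?c})"
      using u_eq[OF t] by (simp add: dde_rhs_def)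
  qed (use u_C in auto)
  let ?I = "{- \<tau> (w b)..0}"
  have I: "b + \<theta> \<in> {b - r \<delta>..b}" if "\<theta> \<in> ?I" for \<theta>
    using delay[of b] that ab by auto
  have I2: "b + \<theta> - \<tau> (w (b + \<theta>)) \<in> {b - 2 * r \<delta>..b}" if "\<theta> \<in> ?I" for \<theta>
    using delay[of "b + \<theta>"] I[OF that] kr a by auto
  have \<eta>_C: "C_on (k - 1) ?I \<eta>"
  proof -
    \<comment> \<open>For \<open>m = k - 1\<close> the smoothing interval starts at
      \<open>a + (k - 2) * r \<delta> = b - 2 * r \<delta>\<close>. The function \<eta> looks back
      no further: one delay for \<theta> and one for the deviated argument.\<close>
    have orbit: "C_on (k - 1) {b - 2 * r \<delta>..b} w"
    proof -
      have "continuous_on {a - r \<delta>..b} w" by (rule continuous_on_subset[OF cont]) (use r \<open>b < c\<close> in auto)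
      moreover have "(w has_vector_derivative dde_rhs f \<tau> w t) (at t within {a..b})" if "t \<in> {a..b}" for t
        by (rule has_vector_derivative_within_subset[OF eq]) (use that \<open>b < c\<close> in auto)
      ultimately have "C_on (k - 1) {a + (real (k - 1) - 1) * r \<delta>..b} w"
        using delay r by (intro C_on_orbit[OF f_smooth tau_smooth]) auto
      then show ?thesis using \<open>k \<ge> 1\<close> by (simp add: a of_nat_diff algebra_simps)
    qed
    have id: "C_on (k - 1) ?I (\<lambda>\<theta>. b + \<theta>)" by (intro C_on_add C_on_const C_on_id)
    have "C_on (k - 1) ?I (\<lambda>\<theta>. w (b + \<theta>))"
      by (rule C_on_compose[OF orbit id]) (use I r in force)
    then have "C_on (k - 1) ?I (\<lambda>\<theta>. \<tau> (w (b + \<theta>)))"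
      by (rule C_on_compose[OF tau_smooth]) simp
    then have "C_on (k - 1) ?I (\<lambda>\<theta>. (b + \<theta>) + - \<tau> (w (b + \<theta>)))"
      by (intro C_on_add[OF id] C_on_bounded_linear[OF bounded_linear_minus[OF bounded_linear_ident]])
    then have "C_on (k - 1) ?I (\<lambda>\<theta>. w ((b + \<theta>) + - \<tau> (w (b + \<theta>))))"
      by (rule C_on_compose[OF orbit]) (use I2 in auto)
    then show ?thesis by (simp add: \<eta>_def)
  qed
  have b0: "\<eta> 0 = w (b - \<tau> (w b))" by (simp add: \<eta>_def)
  have eq_b: "(w has_vector_derivative dde_rhs f \<tau> w b) (at b within {a..b})"
    by (rule has_vector_derivative_within_subset[OF eq]) (use ab \<open>b < c\<close> in auto)
  have "\<eta> \<in> E_set f \<tau> R k \<delta> (w b)"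
    unfolding E_set_def
  proof (intro CollectI conjI exI)
    show "C_on (k - 1) ?I \<eta>" by (rule \<eta>_C)
    show "\<eta> ` ?I \<subseteq> cball 0 \<delta>"
      \<comment> \<open>From \<open>k \<ge> 1\<close> follows
        \<open>a - r \<delta> \<le> b - 2 * r \<delta>\<close>, so all arguments of \<open>w\<close>
        in \<eta> lie where the bound \<delta> is known.\<close>
      using I2 kr by (fastforce simp: \<eta>_def a intro!: small)
    show "0 \<le> w b \<bullet> f (w b) (\<eta> 0)"
      using inner_derivative_nonneg_at_max_norm[OF eq_b ab] small r by (auto simp: x b0 dde_rhs_def)
    show "dde_solution f \<tau> R u (ereal ?c) u" by (rule u_sol)
    have "continuous_on {- R..0} (\<lambda>s. w (a + s))"
      by (rule continuous_on_compose2[OF cont]) (use ab \<open>b < c\<close> in \<open>auto intro!: continuous_intros\<close>)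
    then show "continuous_on {- R..0} u" by (simp add: u_def)
    show "ereal (real k * r \<delta>) < ereal ?c" using \<open>b < c\<close> a by simp
    show "\<forall>\<theta>\<in>?I. \<eta> \<theta> = u (real k * r \<delta> + \<theta> - \<tau> (u (real k * r \<delta> + \<theta>)))"
      by (simp add: \<eta>_def u_def a algebra_simps)
  qed
  \<comment> \<open>Along \<open>w\<close> the delayed value at time \<open>b + \<theta>\<close> is
    exactly \<open>\<eta> \<theta>\<close>, so the delay equation reads as the auxiliary ODE; the
    starting value is \<open>w (b - \<tau> (w b)) = \<eta> 0\<close>.\<close>
  moreover have "aux_solution f \<tau> (w b) \<eta> (\<lambda>\<theta>. w (b + \<theta>))"
    unfolding aux_solution_def
  proof (intro conjI ballI)
    show "w (b + - \<tau> (w b)) = \<eta> 0" by (simp add: b0)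
    fix \<theta> assume \<theta>: "\<theta> \<in> ?I"
    have "(w has_vector_derivative dde_rhs f \<tau> w (b + \<theta>)) (at (b + \<theta>) within (+) b ` ?I)"
      by (rule has_vector_derivative_within_subset[OF eq])
        (use I[OF \<theta>] delay[of b] kr ab \<open>b < c\<close> in \<open>auto simp: a\<close>)
    then show "((\<lambda>\<theta>. w (b + \<theta>)) has_vector_derivative f (w (b + \<theta>)) (\<eta> \<theta>)) (at \<theta> within ?I)"
      by (simp add: \<eta>_def dde_rhs_def has_vector_derivative_shift)
  qed
  ultimately have "1 / \<delta> * (w b \<bullet> w b) < \<delta>" using criterion[OF x] by fastforce
  then show False using x \<delta> by (simp add: dot_square_norm power2_eq_square)
qed

end

section \<open>First hitting times and a priori bounds for small solutions\<close>

lemma first_hit: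
  fixes g h :: "real \<Rightarrow> real"
  assumes "continuous_on {a..b} g" and "continuous_on {a..b} h" and "g a < h a" and "h b \<le> g b" and "a \<le> b"
  obtains c where "c \<in> {a<..b}" and "g c = h c" and "\<And>s. s \<in> {a..<c} \<Longrightarrow> g s < h s"
proof -
  let ?S = "{t \<in> {a..b}. h t \<le> g t}"
  have "closed ?S" using assms(1,2) by (intro continuous_on_closed_Collect_le) auto
  moreover have "bounded ?S" by (rule bounded_subset[OF bounded_closed_interval[of a b]]) auto
  ultimately have "compact ?S" by (simp add: compact_eq_bounded_closed)
  moreover have "?S \<noteq> {}" using assms by auto
  ultimately obtain c where c: "c \<in> ?S" "\<forall>s\<in>?S. c \<le> s"
    using compact_attains_inf[of ?S] by metis
  have less: "g s < h s" if "s \<in> {a..<c}" for s using c(2)[rule_format, of s] c(1) that by force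
  have "continuous_on {a..c} (\<lambda>t. g t - h t)"
    using c(1) by (intro continuous_intros; auto intro: assms(1,2)[THEN continuous_on_subset])
  then obtain x where x: "a \<le> x" "x \<le> c" "g x - h x = 0"
    using IVT'[of "\<lambda>t. g t - h t" a 0 c] assms(3) c(1) by auto
  then have "x = c" using less[of x] by force
  then show ?thesis using that[of c] x less c(1) assms(3) by force
qed

lemma continuous_on_Icc_Un_right:
  fixes g :: "real \<Rightarrow> 'a::topological_space"
  assumes "continuous_on {a..b} g" and "continuous_on S g" and "b \<in> S" and "S \<subseteq> {b..}"
  shows "continuous_on ({a..b} \<union> S) g"
proof (rule continuous_on_Un_local[OF _ _ assms(1,2)])
  show "closedin (top_of_set ({a..b} \<union> S)) {a..b}"
    unfolding closedin_closed using assms(3,4) by (intro exI[of _ "{a..b}"]) auto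
  show "closedin (top_of_set ({a..b} \<union> S)) S"
    unfolding closedin_closed using assms(3,4) by (intro exI[of _ "{b..}"]) force
qed

text \<open>Global existence is formulated with a history on the whole left half-line; a history on
  a compact interval is continued to the left by its value at \<open>a\<close>.\<close>

lemma uniformly_continuous_on_clamp:
  fixes \<phi> :: "real \<Rightarrow> 'a::metric_space"
  assumes "continuous_on {a..b} \<phi>" and "a \<le> b"
  shows "uniformly_continuous_on {..b} (\<lambda>s. \<phi> (max a s))"
  unfolding uniformly_continuous_on_def
proof (intro allI impI)
  fix e :: real assume e: "0 < e"
  have "uniformly_continuous_on {a..b} \<phi>"
    by (rule compact_uniformly_continuous[OF assms(1) compact_Icc])
  from this[unfolded uniformly_continuous_on_def, rule_format, OF e]
  obtain d where d: "0 < d" "\<forall>s\<in>{a..b}. \<forall>t\<in>{a..b}. dist t s < d \<longrightarrow> dist (\<phi> t) (\<phi> s) < e" by blast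
  have "dist (\<phi> (max a t)) (\<phi> (max a s)) < e" if "s \<le> b" "t \<le> b" "dist t s < d" for s t
    using d(2)[rule_format, of "max a s" "max a t"] that assms(2) by (auto simp: dist_real_def max_def)
  then show "\<exists>d>0. \<forall>s\<in>{..b}. \<forall>t\<in>{..b}. dist t s < d \<longrightarrow> dist (\<phi> (max a t)) (\<phi> (max a s)) < e"
    using d(1) by auto
qed

lemma lipschitz_on_bounded_vector_derivative:
  fixes w :: "real \<Rightarrow> 'a::real_normed_vector"
  assumes "\<And>t. t \<in> S \<Longrightarrow> (w has_vector_derivative w' t) (at t within S)" and "convex S"
    and "\<And>t. t \<in> S \<Longrightarrow> norm (w' t) \<le> C" and "0 \<le> C"
  shows "C-lipschitz_on S w"
proof (rule bounded_derivative_imp_lipschitz[OF _ assms(2) _ assms(4)])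
  show "(w has_derivative (\<lambda>h. h *\<^sub>R w' t)) (at t within S)" if "t \<in> S" for t
    using assms(1)[OF that] by (simp add: has_vector_derivative_def)
  show "onorm (\<lambda>h. h *\<^sub>R w' t) \<le> C" if "t \<in> S" for t
    using assms(3)[OF that] by (intro onorm_le) (auto simp: mult.commute[of C] intro: mult_left_mono)
qed

locale stable_dde = state_dependent_dde +
  fixes k :: nat and \<delta>1 :: real
  assumes k: "k \<ge> 1"
    and f_smooth: "C_on (k - 2) UNIV (\<lambda>(u, v). f u v)"
    and tau_smooth: "C_on (k - 1) UNIV \<tau>"
    and delta1: "0 < \<delta>1" "\<delta>1 \<le> \<delta>0"
    and criterion:
      "\<forall>\<delta>\<in>{0<..<\<delta>1}. \<forall>x. norm x = \<delta> \<longrightarrow>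
         (\<forall>\<eta>\<in>E_set f \<tau> (max_delay \<tau> \<delta>0) k \<delta> x. \<forall>v. aux_solution f \<tau> x \<eta> v \<longrightarrow>
            1 / \<delta> * (v 0 \<bullet> x) < \<delta>)"
begin

lemma no_critical_orbit':
  assumes "\<delta> \<in> {0<..<\<delta>1}" and "a = b - real k * r \<delta>" and "b < c"
    and "continuous_on {a - R..<c} w"
    and "\<And>t. t \<in> {a..<c} \<Longrightarrow> (w has_vector_derivative dde_rhs f \<tau> w t) (at t within {a..<c})"
    and "\<And>t. t \<in> {a - r \<delta>..b} \<Longrightarrow> norm (w t) \<le> \<delta>"
    and "\<And>t. t \<in> {a..<c} \<Longrightarrow> norm (w t) \<le> \<delta>0"
  shows "norm (w b) \<noteq> \<delta>"
proof (rule no_critical_orbit[OF k f_smooth tau_smooth _ _ _ assms(2-)])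
  show "0 < \<delta>" "\<delta> \<le> \<delta>0" using assms(1) delta1 by auto
  show "1 / \<delta> * (v 0 \<bullet> x) < \<delta>"
    if "norm x = \<delta>" "\<eta> \<in> E_set f \<tau> R k \<delta> x" "aux_solution f \<tau> x \<eta> v" for x \<eta> v
    using criterion assms(1) that by blast
qed

text \<open>Let \<open>c\<close> be the first time at which the norm meets the envelope
  \<open>N * exp (L * t)\<close>. Before \<open>c\<close> the derivative of \<open>u\<close> is at
  most that of the envelope, so \<open>u\<close> moves by at most \<open>N * exp (L * c) - N\<close>
  up to \<open>c\<close>; this is too little, since \<open>norm (u 0) < N\<close> strictly.\<close>

lemma gronwall_bound:
  assumes "0 < \<delta>" "\<delta> \<le> \<delta>0" and "0 < N"
    and cont: "continuous_on {0..b} u"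
    and eq: "\<And>t. t \<in> {0<..<b} \<Longrightarrow> (u has_vector_derivative dde_rhs f \<tau> u t) (at t)"
    and small: "\<And>t. t \<in> {0..b} \<Longrightarrow> norm (u t) \<le> \<delta>"
    and init: "\<And>s. s \<in> {- r \<delta>..0} \<Longrightarrow> norm (u s) < N" and "N \<le> \<delta>"
    and t: "t \<in> {0..b}"
  shows "norm (u t) < N * exp (L * t)"
proof (rule ccontr)
  assume "\<not> norm (u t) < N * exp (L * t)"
  then have "N * exp (L * t) \<le> norm (u t)" by simp
  moreover have "continuous_on {0..t} (\<lambda>t. norm (u t))"
    using t by (intro continuous_intros continuous_on_subset[OF cont]) auto
  moreover have "continuous_on {0..t} (\<lambda>t. N * exp (L * t))" by (intro continuous_intros)
  moreover have init0: "norm (u 0) < N" using init[of 0] max_delay_pos[of \<delta>] \<open>0 < \<delta>\<close> by simp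
  ultimately obtain c where c: "c \<in> {0<..t}" "norm (u c) = N * exp (L * c)"
    "\<And>s. s \<in> {0..<c} \<Longrightarrow> norm (u s) < N * exp (L * s)"
    using first_hit[of 0 t "\<lambda>t. norm (u t)" "\<lambda>t. N * exp (L * t)"] t by auto
  have "norm (u c - u 0) \<le> N * exp (L * c) - N * exp (L * 0)"
  proof (rule differentiable_bound_general)
    show "0 < c" using c(1) by simp
    show "continuous_on {0..c} u" using c(1) t by (intro continuous_on_subset[OF cont]) auto
    show "continuous_on {0..c} (\<lambda>t. N * exp (L * t))" by (intro continuous_intros)
    fix s assume s: "0 < s" "s < c"
    show "(u has_vector_derivative dde_rhs f \<tau> u s) (at s)" using eq s c(1) t by auto
    show "((\<lambda>t. N * exp (L * t)) has_vector_derivative N * (exp (L * s) * L)) (at s)"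
      by (auto intro!: derivative_eq_intros simp flip: has_real_derivative_iff_has_vector_derivative)
    have us: "norm (u s) \<le> \<delta>" using small s c(1) t by auto
    define q where "q = s - \<tau> (u s)"
    have q: "- r \<delta> \<le> q" "q \<le> s"
      using tau_le_max_delay[OF us] tau_ge_0[of "u s"] us \<open>\<delta> \<le> \<delta>0\<close> s by (auto simp: q_def)
    have mono: "N * exp (L * q') \<le> N * exp (L * s)" if "q' \<le> s" for q'
      using that \<open>0 < N\<close> L_pos by simp
    \<comment> \<open>The envelope is increasing, so its value at \<open>s\<close> also bounds the
      delayed value, whether \<open>q\<close> lies in the solution range or in the history, where
      \<open>N\<close> is the bound.\<close>
    have uq: "norm (u q) \<le> N * exp (L * s) \<and> norm (u q) \<le> \<delta>"
    proof (cases "0 \<le> q")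
      case True
      then show ?thesis using c(3)[of q] q mono[of q] s c(1) t small[of q] by force
    next
      case False
      then show ?thesis using init[of q] q mono[of 0] s \<open>N \<le> \<delta>\<close> by force
    qed
    have "norm (dde_rhs f \<tau> u s) \<le> L0 * norm (u s) + L1 * norm (u q)"
      unfolding dde_rhs_def q_def[symmetric] using us uq \<open>\<delta> \<le> \<delta>0\<close> by (intro f_bound) auto
    also have "\<dots> \<le> L0 * (N * exp (L * s)) + L1 * (N * exp (L * s))"
      using uq c(3)[of s] s const_pos by (intro add_mono mult_left_mono) auto
    finally show "norm (dde_rhs f \<tau> u s) \<le> N * (exp (L * s) * L)" by (simp add: L algebra_simps)
  qed
  then show False using c(2) init0 norm_triangle_ineq2[of "u c" "u 0"] by simp
qed

text \<open>The equation is assumed only as long as the solution stays in \<open>cball 0 \<delta>0\<close>, so that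
  the bound applies to the given equation and to its truncation alike.\<close>

lemma solution_bound:
  assumes \<delta>: "\<delta> \<in> {0<..<\<delta>1}"
    and cont: "continuous_on {- R..<T} u"
    and eq: "\<And>t. t \<in> {0..<T} \<Longrightarrow> norm (u t) \<le> \<delta>0 \<Longrightarrow> norm (u (t - \<tau> (u t))) \<le> \<delta>0 \<Longrightarrow>
      (u has_vector_derivative dde_rhs f \<tau> u t) (at t within {0..<T})"
    and init: "\<And>s. s \<in> {- r \<delta>..0} \<Longrightarrow> norm (u s) < \<delta> * exp (- (L * real k * r \<delta>))"
    and t: "t \<in> {0..<T}"
  shows "norm (u t) < \<delta>"
proof (rule ccontr)
  assume "\<not> norm (u t) < \<delta>"
  have \<delta>': "0 < \<delta>" "\<delta> < \<delta>0" using \<delta> delta1 by auto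
  have r: "0 < r \<delta>" "r \<delta> \<le> R" using \<delta>' by (auto intro: max_delay_pos max_delay_mono)
  define N where "N = \<delta> * exp (- (L * real k * r \<delta>))"
  have N: "0 < N" "N \<le> \<delta>" using \<delta>' L_pos r by (auto simp: N_def)
  have "norm (u 0) < \<delta>" using init[of 0] N r by (auto simp: N_def)
  moreover have "continuous_on {0..t} (\<lambda>t. norm (u t))"
    using t r by (intro continuous_intros continuous_on_subset[OF cont]) auto
  ultimately obtain b where b: "b \<in> {0<..t}" "norm (u b) = \<delta>"
    and less: "\<And>s. s \<in> {0..<b} \<Longrightarrow> norm (u s) < \<delta>"
    using first_hit[of 0 t "\<lambda>t. norm (u t)" "\<lambda>t. \<delta>"] t \<open>\<not> norm (u t) < \<delta>\<close> by auto
  have small: "norm (u s) \<le> \<delta>" if s: "s \<in> {- r \<delta>..b}" for s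
  proof -
    consider "s \<in> {0..<b}" | "s = b" | "s \<in> {- r \<delta>..0}" using s by fastforce
    then show ?thesis using less[of s] init[of s, folded N_def] N b(2) by cases auto
  qed
  have delay: "\<tau> (u s) \<in> {0..r \<delta>}" if "s \<in> {0..b}" for s
    using small[of s] that r \<delta>' by (auto intro!: tau_ge_0 tau_le_max_delay)
  have deriv: "(u has_vector_derivative dde_rhs f \<tau> u s) (at s within {0..<T})" if "s \<in> {0..b}" for s
    using delay[OF that] that b(1) t small[of s] small[of "s - \<tau> (u s)"] \<delta>' r by (intro eq) auto
  have kr: "r \<delta> \<le> real k * r \<delta>" using k r by simp
  \<comment> \<open>At the hitting time \<open>\<delta> < N * exp (L * b) = \<delta> * exp (L * (b -
    k * r \<delta>))\<close>, so the exponent is positive.\<close>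
  have late: "real k * r \<delta> < b"
  proof -
    have "norm (u b) < N * exp (L * b)"
    proof (rule gronwall_bound[of \<delta> N b u b])
      show "continuous_on {0..b} u" using b(1) t r by (intro continuous_on_subset[OF cont]) auto
      show "(u has_vector_derivative dde_rhs f \<tau> u s) (at s)" if "s \<in> {0<..<b}" for s
      proof -
        have "at s within {0..<T} = at s"
          by (rule at_within_interior) (use that b(1) t in auto)
        then show ?thesis using deriv[of s] that by simp
      qed
    qed (use \<delta>' N small init b r in \<open>auto simp: N_def\<close>)
    then have "\<delta> < \<delta> * exp (L * (b - real k * r \<delta>))"
      unfolding b(2) by (simp add: N_def mult_exp_exp algebra_simps)
    then show ?thesis using \<delta>'(1) L_pos by (simp add: zero_less_mult_iff)
  qed
  \<comment> \<open>From here on a time \<open>c > b\<close> is sought such that \<open>u\<close>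
    and its delayed value stay within \<delta>0 on \<open>(b, c)\<close>, because the equation is
    assumed only there. At \<open>b\<close> both norms are at most
    \<open>\<delta> < \<delta>0\<close>, and the delayed argument at \<open>b\<close> is positive,
    hence inside the open range of two-sided continuity.\<close>
  have isCont: "isCont u s" if "s \<in> {- R<..<T}" for s
    by (rule continuous_on_interior[OF cont]) (use that in auto)
  have b_delay: "0 < b - \<tau> (u b)" "b - \<tau> (u b) \<le> b"
    using delay[of b] b(1) kr late unfolding atLeastAtMost_iff greaterThanAtMost_iff by linarith+
  have ib: "isCont u b" using isCont[of b] b(1) t r by simp
  have "isCont \<tau> (u b)" using tau_cont by (simp add: continuous_on_eq_continuous_at)
  then have "isCont (\<lambda>s. s - \<tau> (u s)) b" using ib isCont_o2 by (intro continuous_intros) blast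
  moreover have "isCont u (b - \<tau> (u b))" using isCont b_delay b(1) t r by simp
  ultimately have ib': "isCont (\<lambda>s. u (s - \<tau> (u s))) b" by (rule isCont_o2)
  have "norm (u (b - \<tau> (u b))) < \<delta>0"
    using small[of "b - \<tau> (u b)"] b_delay r \<delta>'(2) by simp
  then have "\<forall>\<^sub>F s in at b. norm (u (s - \<tau> (u s))) < \<delta>0"
    using ib' by (intro order_tendstoD(2)[OF tendsto_norm]) (auto simp: isCont_def)
  moreover have "\<forall>\<^sub>F s in at b. norm (u s) < \<delta>0"
    using ib b(2) \<delta>'(2) by (intro order_tendstoD(2)[OF tendsto_norm]) (auto simp: isCont_def)
  ultimately have "\<forall>\<^sub>F s in at b. norm (u s) < \<delta>0 \<and> norm (u (s - \<tau> (u s))) < \<delta>0"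
    by (simp add: eventually_conj)
  then obtain e where e: "0 < e" "\<And>s. s \<noteq> b \<Longrightarrow> dist s b < e \<Longrightarrow> norm (u s) < \<delta>0 \<and> norm (u (s - \<tau> (u s))) < \<delta>0"
    unfolding eventually_at by blast
  define c where "c = min T (b + e)"
  have c: "b < c" "c \<le> T" using e(1) b(1) t by (auto simp: c_def)
  have near: "norm (u s) \<le> \<delta>0 \<and> norm (u (s - \<tau> (u s))) \<le> \<delta>0" if "s \<in> {b<..<c}" for s
    using e(2)[of s] that by (auto simp: c_def dist_real_def intro: less_imp_le)
  have "norm (u b) \<noteq> \<delta>"
  proof (rule no_critical_orbit'[OF \<delta> refl c(1)])
    show "continuous_on {b - real k * r \<delta> - R..<c} u"
      by (rule continuous_on_subset[OF cont]) (use late c in auto)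
    show "norm (u s) \<le> \<delta>" if "s \<in> {b - real k * r \<delta> - r \<delta>..b}" for s
      using small[of s] that late by auto
    fix s assume s: "s \<in> {b - real k * r \<delta>..<c}"
    have "norm (u s) \<le> \<delta>0 \<and> (u has_vector_derivative dde_rhs f \<tau> u s) (at s within {0..<T})"
    proof (cases "s \<le> b")
      case True
      then have "s \<in> {0..b}" using s late by auto
      then show ?thesis using deriv[of s] small[of s] \<delta>' r by auto
    next
      case False
      then show ?thesis using near[of s] s eq[of s] c b(1) by auto
    qed
    then show "norm (u s) \<le> \<delta>0"
      and "(u has_vector_derivative dde_rhs f \<tau> u s) (at s within {b - real k * r \<delta>..<c})"
      by (auto elim!: has_vector_derivative_within_subset) (use late c in auto)
  qed
  then show False using b(2) by simp
qed

end

subsection \<open>Truncation and global solutions\<close>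

context state_dependent_dde
begin

text \<open>A continuous retraction onto the closed ball. Composition with it leaves
  \<open>f\<close> and \<tau> unchanged on the ball, while the bound \<open>L * \<delta>0\<close>
  for \<open>f\<close> and nonnegativity of \<tau> become global.\<close>

definition proj :: "real ^ 'd \<Rightarrow> real ^ 'd" where
  "proj = closest_point (cball 0 \<delta>0)"

definition G :: "real ^ 'd \<Rightarrow> real ^ 'd \<Rightarrow> real ^ 'd" where
  "G u v = f (proj u) (proj v)"

definition \<sigma> :: "real ^ 'd \<Rightarrow> real" where
  "\<sigma> u = \<tau> (proj u)"

lemma proj_norm: "norm (proj u) \<le> \<delta>0"
  using closest_point_in_set[of "cball 0 \<delta>0" u] const_pos by (simp add: proj_def)

lemma proj_self: "norm u \<le> \<delta>0 \<Longrightarrow> proj u = u"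
  by (simp add: proj_def closest_point_self)

lemma proj_cont: "continuous_on S proj"
  unfolding proj_def using const_pos by (intro continuous_on_closest_point) auto

lemma dde_rhs_truncated:
  "norm (u t) \<le> \<delta>0 \<Longrightarrow> norm (u (t - \<tau> (u t))) \<le> \<delta>0 \<Longrightarrow> dde_rhs G \<sigma> u t = dde_rhs f \<tau> u t"
  by (simp add: dde_rhs_def G_def \<sigma>_def proj_self)

sublocale truncated: bounded_dde G \<sigma> "L * \<delta>0"
proof
  have "continuous_on UNIV (\<lambda>p. (proj (fst p), proj (snd p)))"
    by (intro continuous_on_Pair continuous_on_compose2[OF proj_cont[of UNIV]] continuous_intros) auto
  from continuous_on_compose2[OF f_cont this] show "continuous_on UNIV (\<lambda>(u, v). G u v)"
    by (simp add: G_def case_prod_beta)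
  show "continuous_on UNIV \<sigma>"
    unfolding \<sigma>_def by (rule continuous_on_compose2[OF tau_cont proj_cont]) simp
  show "0 \<le> \<sigma> u" for u by (simp add: \<sigma>_def tau_ge_0 proj_norm)
  show "norm (G u v) \<le> L * \<delta>0" for u v
  proof -
    have "norm (G u v) \<le> L0 * norm (proj u) + L1 * norm (proj v)"
      unfolding G_def by (intro f_bound proj_norm)
    also have "\<dots> \<le> L0 * \<delta>0 + L1 * \<delta>0"
      using const_pos proj_norm by (intro add_mono mult_left_mono) auto
    finally show ?thesis by (simp add: L algebra_simps)
  qed
qed

lemma dde_solution_continuous_on:
  assumes "dde_solution f \<tau> R \<phi> tf u" and "continuous_on {- R..0} \<phi>"
  shows "continuous_on ({- R..0} \<union> time_interval tf) u"
proof (rule continuous_on_Icc_Un_right)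
  show "continuous_on {- R..0} u"
    by (rule continuous_on_eq[OF assms(2)]) (use assms(1) in \<open>simp add: dde_solution_def\<close>)
  have "C_on 1 (time_interval tf) u" using assms(1) by (simp add: dde_solution_def)
  then have "C_on 0 (time_interval tf) u" by (rule C_on_antimono) simp
  then show "continuous_on (time_interval tf) u" by simp
qed (use assms(1) in \<open>auto simp: dde_solution_def time_interval_def zero_ereal_def\<close>)

lemma dde_solution_derivative:
  assumes "dde_solution f \<tau> R \<phi> tf u" and "t \<in> time_interval tf"
  shows "(u has_vector_derivative dde_rhs f \<tau> u t) (at t within time_interval tf)"
    and "t - \<tau> (u t) \<in> {- R..0} \<union> time_interval tf"
  using assms by (auto simp: dde_solution_def dde_rhs_def)

end

section \<open>A priori bound and continuation for solutions of the given equation\<close>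

context stable_dde
begin

lemma dde_solution_bound:
  assumes \<delta>: "\<delta> \<in> {0<..<\<delta>1}" and \<phi>: "continuous_on {- R..0} \<phi>"
    and init: "\<And>s. s \<in> {- r \<delta>..0} \<Longrightarrow> norm (\<phi> s) < \<delta> * exp (- (L * real k * r \<delta>))"
    and sol: "dde_solution f \<tau> R \<phi> tf u" and t: "t \<in> time_interval tf"
  shows "norm (u t) < \<delta>"
proof -
  have r: "r \<delta> \<le> R" using \<delta> delta1 by (intro max_delay_mono) auto
  obtain T where T: "t < T" "ereal T \<le> tf"
  proof (cases tf)
    case (real T)
    then show ?thesis using t that[of T] by (simp add: time_interval_def)
  next
    case PInf
    then show ?thesis using that[of "t + 1"] by simp
  qed (use t in \<open>simp add: time_interval_def\<close>)
  have sub: "{0..<T} \<subseteq> time_interval tf"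
    using T(2) by (auto simp: time_interval_def) (meson ereal_less_eq(3) less_ereal.simps(1) less_le_trans)
  show ?thesis
  proof (rule solution_bound[OF \<delta>])
    show "continuous_on {- R..<T} u"
    proof (rule continuous_on_subset[OF dde_solution_continuous_on[OF sol \<phi>]])
      have "{- R..<T} \<subseteq> {- R..0} \<union> {0..<T}" by auto
      then show "{- R..<T} \<subseteq> {- R..0} \<union> time_interval tf" using sub by blast
    qed
    show "(u has_vector_derivative dde_rhs f \<tau> u s) (at s within {0..<T})" if "s \<in> {0..<T}" for s
      using dde_solution_derivative(1)[OF sol, of s] sub that
      by (blast intro: has_vector_derivative_within_subset)
    show "norm (u s) < \<delta> * exp (- (L * real k * r \<delta>))" if "s \<in> {- r \<delta>..0}" for s
      using init[OF that] sol r that by (auto simp: dde_solution_def)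
    show "t \<in> {0..<T}" using t T(1) by (simp add: time_interval_def)
  qed
qed

text \<open>With \<open>a = 0\<close> this is existence, with \<open>a\<close> a finite end time it
  is continuation. The truncated equation is solved from time \<open>a\<close> on with
  \<open>v\<close> as history; the a priori bound then keeps the result below \<delta>, where
  truncation changes nothing.\<close>

lemma extend_solution:
  assumes \<delta>: "\<delta> \<in> {0<..<\<delta>1}" and "0 \<le> a"
    and cont: "continuous_on {- R..a} v"
    and init: "\<And>s. s \<in> {- r \<delta>..0} \<Longrightarrow> norm (v s) < \<delta> * exp (- (L * real k * r \<delta>))"
    and eq: "\<And>t. t \<in> {0..<a} \<Longrightarrow> (v has_vector_derivative dde_rhs f \<tau> v t) (at t within {0..<a})"
    and small: "\<And>t. t \<in> {0..<a} \<Longrightarrow> norm (v t) < \<delta>"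
  obtains w where "dde_solution f \<tau> R v \<infinity> w" and "\<And>t. t \<in> {- R..a} \<Longrightarrow> w t = v t"
proof -
  have \<delta>': "0 < \<delta>" "\<delta> < \<delta>0" using \<delta> delta1 by auto
  have r: "0 < r \<delta>" "r \<delta> \<le> R" using \<delta>' by (auto intro: max_delay_pos max_delay_mono)
  have "uniformly_continuous_on {..a} (\<lambda>s. v (max (- R) s))"
    using r \<open>0 \<le> a\<close> by (intro uniformly_continuous_on_clamp cont) auto
  then obtain w where w_cont: "continuous_on UNIV w" and w_left: "\<And>t. t \<le> a \<Longrightarrow> w t = v (max (- R) t)"
    and w_right: "\<And>t. a \<le> t \<Longrightarrow> (w has_vector_derivative dde_rhs G \<sigma> w t) (at t within {a..})"
    using truncated.ex_global_solution by blast
  have wv: "w t = v t" if "t \<in> {- R..a}" for t using w_left that by simp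
  have rhs_cont: "continuous_on S (dde_rhs G \<sigma> w)" for S
    by (rule truncated.dde_rhs_continuous_on[OF w_cont]) auto
  have early: "norm (w t) \<le> \<delta>" if "t \<in> {- r \<delta>..<a}" for t
  proof (cases "t < 0")
    case True
    then have "norm (w t) < \<delta> * exp (- (L * real k * r \<delta>))"
      using wv[of t] init[of t] that r by simp
    also have "\<dots> \<le> \<delta>" using L_pos r \<delta>'(1) by simp
    finally show ?thesis by simp
  next
    case False
    then show ?thesis using wv[of t] small[of t] that r by simp
  qed
  have eq_w: "(w has_vector_derivative dde_rhs G \<sigma> w t) (at t)" if "t \<in> {0<..<a} \<union> {a<..}" for t
  proof (cases "t < a")
    case True
    then have t: "t \<in> {0<..<a}" using that by auto
    then have wt: "norm (w t) \<le> \<delta>" using early[of t] r by simp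
    then have "\<tau> (w t) \<in> {0..r \<delta>}" using \<delta>' by (auto intro!: tau_ge_0 tau_le_max_delay)
    then have q: "t - \<tau> (w t) \<in> {- r \<delta>..<a}" using t by auto
    have "dde_rhs G \<sigma> w t = dde_rhs f \<tau> w t"
      using wt early[OF q] \<delta>' by (intro dde_rhs_truncated) auto
    also have "\<dots> = dde_rhs f \<tau> v t" using wv[of t] wv[of "t - \<tau> (w t)"] t q r by (simp add: dde_rhs_def)
    finally have rhs: "dde_rhs G \<sigma> w t = dde_rhs f \<tau> v t" .
    have "at t within {0..<a} = at t" by (rule at_within_interior) (use t in auto)
    then have "(v has_vector_derivative dde_rhs f \<tau> v t) (at t)" using eq[of t] t by simp
    then show ?thesis unfolding rhs
      by (rule has_vector_derivative_transform_within_open[of _ _ _ "{0<..<a}"])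
        (use t wv r in auto)
  next
    case False
    have "at t within {a..} = at t" by (rule at_within_interior) (use that False in auto)
    then show ?thesis using w_right[of t] False by simp
  qed
  have "(w has_vector_derivative dde_rhs G \<sigma> w t) (at t within {0..})" if "0 \<le> t" for t
  proof (rule has_vector_derivative_if_integral[OF rhs_cont _ that])
    fix t :: real assume "0 \<le> t"
    \<comment> \<open>At the gluing time \<open>a\<close> only one-sided information is at hand. The
      fundamental theorem tolerates this exceptional point, and continuity of the integrand then
      returns the derivative at \<open>a\<close> as well.\<close>
    have "(dde_rhs G \<sigma> w has_integral (w t - w 0)) {0..t}"
    proof (rule fundamental_theorem_of_calculus_interior_strong[of "{a}"])
      show "(w has_vector_derivative dde_rhs G \<sigma> w s) (at s)" if "s \<in> {0<..<t} - {a}" for s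
        using that by (intro eq_w) auto
      show "continuous_on {0..t} w" by (rule continuous_on_subset[OF w_cont]) simp
    qed (use \<open>0 \<le> t\<close> in auto)
    then show "w t = w 0 + integral {0..t} (dde_rhs G \<sigma> w)" by (simp add: integral_unique)
  qed
  then have eq_w': "(w has_vector_derivative dde_rhs f \<tau> w t) (at t within {0..})"
    if "0 \<le> t" "norm (w t) \<le> \<delta>0" "norm (w (t - \<tau> (w t))) \<le> \<delta>0" for t
    using that dde_rhs_truncated by metis
  have w_small: "norm (w t) < \<delta>" if "0 \<le> t" for t
  proof (rule solution_bound[OF \<delta>, of "t + 1"])
    show "continuous_on {- R..<t + 1} w" by (rule continuous_on_subset[OF w_cont]) simp
    show "(w has_vector_derivative dde_rhs f \<tau> w s) (at s within {0..<t + 1})"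
      if "s \<in> {0..<t + 1}" "norm (w s) \<le> \<delta>0" "norm (w (s - \<tau> (w s))) \<le> \<delta>0" for s
      by (rule has_vector_derivative_within_subset[OF eq_w']) (use that in auto)
    show "norm (w s) < \<delta> * exp (- (L * real k * r \<delta>))" if "s \<in> {- r \<delta>..0}" for s
      using init[OF that] wv[of s] that r \<open>0 \<le> a\<close> by simp
  qed (use that in simp)
  have w_small': "norm (w t) \<le> \<delta>" if "- r \<delta> \<le> t" for t
    using early[of t] w_small[of t] that \<open>0 \<le> a\<close> by force
  have delay: "\<tau> (w t) \<in> {0..r \<delta>}" if "0 \<le> t" for t
    using w_small[OF that] \<delta>' by (auto intro!: tau_ge_0 tau_le_max_delay)
  have eq_f: "(w has_vector_derivative dde_rhs f \<tau> w t) (at t within {0..})" if "0 \<le> t" for t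
    using w_small'[of t] w_small'[of "t - \<tau> (w t)"] delay[OF that] that r \<delta>' by (intro eq_w') auto
  have "continuous_on {0..} (dde_rhs f \<tau> w)"
    by (rule continuous_on_dde_rhs[OF f_cont tau_cont w_cont]) auto
  then have "C_on 1 {0..} w"
    using C_on_SucI_vector[of "{0..}" w "dde_rhs f \<tau> w" 0] eq_f by simp
  then have "dde_solution f \<tau> R v \<infinity> w"
    unfolding dde_solution_def time_interval_PInf
    using wv \<open>0 \<le> a\<close> eq_f delay r by (force simp: dde_rhs_def)
  then show ?thesis using that wv by blast
qed

lemma global_solutions_bounded:
  assumes \<delta>: "\<delta> \<in> {0<..<\<delta>1}" and \<phi>: "continuous_on {- R..0} \<phi>"
    and init: "\<And>s. s \<in> {- r \<delta>..0} \<Longrightarrow> norm (\<phi> s) < \<delta> * exp (- (L * real k * r \<delta>))"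
  shows "global_solutions_satisfy f \<tau> R \<phi> (\<lambda>u. \<forall>t\<ge>0. norm (u t) < \<delta>)"
  unfolding global_solutions_satisfy_def
proof (intro conjI allI impI)
  show "\<exists>u. dde_solution f \<tau> R \<phi> \<infinity> u"
    by (rule extend_solution[OF \<delta> order_refl \<phi> init]) auto
  show "norm (u t) < \<delta>" if "dde_solution f \<tau> R \<phi> \<infinity> u" "0 \<le> t" for u t
    using dde_solution_bound[OF \<delta> \<phi> init that(1)] that(2) by (simp add: time_interval_PInf)
  fix tf u assume sol: "dde_solution f \<tau> R \<phi> tf u"
  show "\<exists>w. dde_solution f \<tau> R \<phi> \<infinity> w \<and> (\<forall>t\<in>time_interval tf. w t = u t)"
  proof (cases tf)
    case (real a)
    have \<delta>': "0 < \<delta>" "\<delta> < \<delta>0" using \<delta> delta1 by auto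
    have r: "0 < r \<delta>" "r \<delta> \<le> R" using \<delta>' by (auto intro: max_delay_pos max_delay_mono)
    have a: "0 < a" using sol real by (simp add: dde_solution_def)
    have ti: "time_interval tf = {0..<a}" by (simp add: real time_interval_ereal)
    have u\<phi>: "u s = \<phi> s" if "s \<in> {- R..0}" for s using sol that by (simp add: dde_solution_def)
    have small: "norm (u t) < \<delta>" if "t \<in> {0..<a}" for t
      using dde_solution_bound[OF \<delta> \<phi> init sol] that by (simp add: ti)
    have exp_le: "\<delta> * exp (- (L * real k * r \<delta>)) \<le> \<delta>" using L_pos r \<delta>'(1) by simp
    have small': "norm (u t) \<le> \<delta>" if "t \<in> {- r \<delta>..<a}" for t
      using small[of t] init[of t] u\<phi>[of t] exp_le that r by (cases "t < 0") auto
    have eq: "(u has_vector_derivative dde_rhs f \<tau> u t) (at t within {0..<a})" if "t \<in> {0..<a}" for t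
      using dde_solution_derivative(1)[OF sol] that by (simp add: ti)
    have delay: "\<tau> (u t) \<in> {0..r \<delta>}" if "t \<in> {0..<a}" for t
      using small[OF that] \<delta>' by (auto intro!: tau_ge_0 tau_le_max_delay)
    \<comment> \<open>A Lipschitz function has a limit at the missing end point \<open>a\<close>, so
      the partial solution extends continuously to \<open>[-R, a]\<close> and can be continued from
      there.\<close>
    have "(L * \<delta>0)-lipschitz_on {0..<a} u"
    proof (rule lipschitz_on_bounded_vector_derivative[OF eq])
      fix t assume t: "t \<in> {0..<a}"
      have "dde_rhs f \<tau> u t = dde_rhs G \<sigma> u t"
        using small'[of t] small'[of "t - \<tau> (u t)"] delay[OF t] t r \<delta>'
        by (intro dde_rhs_truncated[symmetric]) auto
      then show "norm (dde_rhs f \<tau> u t) \<le> L * \<delta>0" by (simp add: truncated.dde_rhs_bound)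
    qed (use truncated.B_nonneg in auto)
    then have "uniformly_continuous_on {0..<a} u" by (rule lipschitz_on_uniformly_continuous)
    then obtain g where g: "uniformly_continuous_on (closure {0..<a}) g" "\<And>t. t \<in> {0..<a} \<Longrightarrow> u t = g t"
      by (rule uniformly_continuous_on_extension_on_closure) (rule that)
    have cl: "closure {0..<a} = {0..a}" using a by simp
    define v where "v t = (if t \<le> 0 then \<phi> t else g t)" for t
    have v_hist: "v t = \<phi> t" if "t \<in> {- R..0}" for t using that by (simp add: v_def)
    have v_g: "v t = g t" if "t \<in> {0..a}" for t
      using that g(2)[of 0] u\<phi>[of 0] a r by (auto simp: v_def)
    have v_u: "v t = u t" if "t \<in> {- R..<a}" for t
      using that g(2)[of t] u\<phi>[of t] by (auto simp: v_def)
    have "continuous_on {- R..0} v" by (rule continuous_on_eq[OF \<phi>]) (simp add: v_hist)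
    moreover have "continuous_on {0..a} v"
      by (rule continuous_on_eq[OF uniformly_continuous_imp_continuous[OF g(1), unfolded cl]])
        (simp add: v_g)
    ultimately have "continuous_on ({- R..0} \<union> {0..a}) v"
      using a by (intro continuous_on_Icc_Un_right) auto
    moreover have "{- R..0} \<union> {0..a} = {- R..a}" using a r by auto
    ultimately have v_cont: "continuous_on {- R..a} v" by simp
    obtain w where w: "dde_solution f \<tau> R v \<infinity> w" "\<And>t. t \<in> {- R..a} \<Longrightarrow> w t = v t"
    proof (rule extend_solution[OF \<delta> less_imp_le[OF a] v_cont])
      show "norm (v s) < \<delta> * exp (- (L * real k * r \<delta>))" if "s \<in> {- r \<delta>..0}" for s
        using init[OF that] v_hist[of s] that r by simp
      fix t assume t: "t \<in> {0..<a}"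
      show "norm (v t) < \<delta>" using small[OF t] v_u[of t] t r by simp
      have "dde_rhs f \<tau> v t = dde_rhs f \<tau> u t"
        using v_u[of t] v_u[of "t - \<tau> (u t)"] t delay[OF t] r by (simp add: dde_rhs_def)
      then show "(v has_vector_derivative dde_rhs f \<tau> v t) (at t within {0..<a})"
        using has_vector_derivative_transform[OF t _ eq[OF t], of v] v_u r by simp
    qed blast
    have "dde_solution f \<tau> R \<phi> \<infinity> w"
      using w(1) v_hist by (simp add: dde_solution_def)
    then show ?thesis using w(2) v_u r by (intro exI[of _ w]) (auto simp: ti)
  qed (use sol in \<open>auto simp: dde_solution_def\<close>)
qed

end

subsection \<open>Convergence to zero\<close>

lemma global_solutions_satisfy_mono:
  assumes "global_solutions_satisfy f \<tau> R \<phi> P"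
    and "\<And>u. dde_solution f \<tau> R \<phi> \<infinity> u \<Longrightarrow> P u \<Longrightarrow> Q u"
  shows "global_solutions_satisfy f \<tau> R \<phi> Q"
  using assms unfolding global_solutions_satisfy_def by blast

text \<open>The number \<open>d\<close> is the upper limit of \<open>norm (u t)\<close>, taken as
  the infimum of the nonnegative eventual bounds; it is positive because upper limit 0 would mean
  convergence to 0.\<close>

lemma limsup_norm_cases:
  fixes u :: "real \<Rightarrow> 'a::real_normed_vector"
  assumes "\<forall>\<^sub>F t in at_top. norm (u t) \<le> c" and "\<not> (u \<longlongrightarrow> 0) at_top"
  obtains d where "0 < d" and "d \<le> c"
    and "\<And>e. 0 < e \<Longrightarrow> \<forall>\<^sub>F t in at_top. norm (u t) \<le> d + e"
    and "\<And>e n. 0 < e \<Longrightarrow> \<exists>t\<ge>n. d - e < norm (u t)"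
proof -
  define A where "A = {c. 0 \<le> c \<and> (\<forall>\<^sub>F t in at_top. norm (u t) \<le> c)}"
  have "0 \<le> c"
  proof -
    obtain t where "norm (u t) \<le> c" using assms(1) unfolding eventually_at_top_linorder by blast
    then show ?thesis using norm_ge_zero order_trans by blast
  qed
  then have cA: "c \<in> A" using assms(1) by (simp add: A_def)
  have bdd: "bdd_below A" by (rule bdd_belowI[of _ 0]) (simp add: A_def)
  define d where "d = Inf A"
  have upper: "\<forall>\<^sub>F t in at_top. norm (u t) \<le> d + e" if "0 < e" for e
  proof -
    have "Inf A < d + e" using that by (simp add: d_def)
    then obtain c' where "c' \<in> A" "c' < d + e" using cInf_lessD cA by blast
    then show ?thesis by (auto simp: A_def elim: eventually_mono)
  qed
  have "d \<ge> 0" unfolding d_def using cA by (intro cInf_greatest) (auto simp: A_def)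
  moreover have "d \<noteq> 0"
  proof
    assume "d = 0"
    have "(u \<longlongrightarrow> 0) at_top"
    proof (rule tendstoI)
      fix e :: real assume "0 < e"
      then show "\<forall>\<^sub>F t in at_top. dist (u t) 0 < e"
        using upper[of "e / 2"] \<open>d = 0\<close> by (auto elim!: eventually_mono)
    qed
    then show False using assms(2) by simp
  qed
  ultimately have "0 < d" by simp
  have "\<exists>t\<ge>n. d - e < norm (u t)" if "0 < e" for e n
  proof (rule ccontr)
    assume "\<not> ?thesis"
    \<comment> \<open>The maximum with 0 keeps this bound in \<open>A\<close>; it is still smaller
      than \<open>d\<close>, as \<open>d > 0\<close>.\<close>
    then have "\<forall>t\<ge>n. norm (u t) \<le> max 0 (d - e)" by (auto simp: not_less le_max_iff_disj)
    then have "max 0 (d - e) \<in> A" unfolding A_def eventually_at_top_linorder by auto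
    then have "d \<le> max 0 (d - e)" unfolding d_def by (intro cInf_lower bdd)
    then show False using \<open>0 < d\<close> that by simp
  qed
  moreover have "d \<le> c" unfolding d_def by (rule cInf_lower[OF cA bdd])
  ultimately show ?thesis using that \<open>0 < d\<close> upper by blast
qed

context stable_dde
begin

text \<open>If the solution did not tend to \<open>0\<close>, its translates along times where the norm approaches
  its upper limit \<open>d\<close> would accumulate at an entire solution whose norm attains its maximum
  \<open>d\<close> at time \<open>0\<close>.\<close>

lemma bounded_solution_tendsto_0:
  assumes \<delta>: "\<delta> \<in> {0<..<\<delta>1}" and sol: "dde_solution f \<tau> R \<phi> \<infinity> u"
    and small: "\<And>t. 0 \<le> t \<Longrightarrow> norm (u t) \<le> \<delta>"
  shows "(u \<longlongrightarrow> 0) at_top"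
proof (rule ccontr)
  assume "\<not> (u \<longlongrightarrow> 0) at_top"
  moreover have "\<forall>\<^sub>F t in at_top. norm (u t) \<le> \<delta>"
    unfolding eventually_at_top_linorder using small by blast
  ultimately obtain d where d: "0 < d" "d \<le> \<delta>"
    and upper: "\<And>e. 0 < e \<Longrightarrow> \<forall>\<^sub>F t in at_top. norm (u t) \<le> d + e"
    and lower: "\<And>e n. 0 < e \<Longrightarrow> \<exists>t\<ge>n. d - e < norm (u t)"
    using limsup_norm_cases[of u \<delta>] by metis
  have \<delta>0: "\<delta> \<le> \<delta>0" using \<delta> delta1 by simp
  have R: "0 < R" using const_pos by (intro max_delay_pos) simp
  have small0: "norm (u t) \<le> \<delta>0" if "0 \<le> t" for t using small[OF that] \<delta>0 by simp
  have delay: "\<tau> (u t) \<in> {0..R}" if "0 \<le> t" for t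
    using small0[OF that] by (auto intro!: tau_ge_0 tau_le_max_delay)
  have deriv: "(u has_vector_derivative dde_rhs f \<tau> u t) (at t within {0..})" if "0 \<le> t" for t
    using dde_solution_derivative(1)[OF sol] that by (simp add: time_interval_PInf)
  \<comment> \<open>Nothing is known about the size of \<phi>. From time \<open>R\<close> on the
    deviated argument is nonnegative, where the bound \<delta> is available.\<close>
  have rhs: "dde_rhs G \<sigma> u t = dde_rhs f \<tau> u t" if "R \<le> t" for t
    using small0[of t] small0[of "t - \<tau> (u t)"] delay[of t] that R by (intro dde_rhs_truncated) auto
  have lip: "norm (u s - u t) \<le> L * \<delta>0 * \<bar>s - t\<bar>" if "R \<le> s" "R \<le> t" for s t
  proof -
    have "(L * \<delta>0)-lipschitz_on {R..} u"
    proof (rule lipschitz_on_bounded_vector_derivative)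
      show "(u has_vector_derivative dde_rhs f \<tau> u t) (at t within {R..})" if "t \<in> {R..}" for t
        by (rule has_vector_derivative_within_subset[OF deriv]) (use that R in auto)
      show "norm (dde_rhs f \<tau> u t) \<le> L * \<delta>0" if "t \<in> {R..}" for t
        using truncated.dde_rhs_bound[of u t] rhs[of t] that by simp
    qed (use truncated.B_nonneg in auto)
    from lipschitz_onD[OF this, of s t] show ?thesis using that by (simp add: dist_norm)
  qed
  obtain s where s: "\<And>n::nat. real n \<le> s n" "\<And>n. d - 1 / real (Suc n) < norm (u (s n))"
    using lower[of "1 / real (Suc n)" "real n" for n] by (metis divide_pos_pos of_nat_0_less_iff zero_less_Suc zero_less_one)
  have s_lim: "filterlim s at_top sequentially"
    by (rule filterlim_at_top_mono[OF filterlim_real_sequentially]) (simp add: s(1))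
  have late: "\<forall>\<^sub>F n in sequentially. c \<le> s n + t" for c t
  proof -
    have "\<forall>\<^sub>F n in sequentially. c - t \<le> s n" using s_lim by (simp add: filterlim_at_top)
    then show ?thesis by (simp add: diff_le_eq)
  qed
  \<comment> \<open>The cut-off at \<open>R\<close> makes all translates functions on the whole line
    with the common Lipschitz constant \<open>L * \<delta>0\<close>. For fixed \<open>t\<close> it
    is eventually inactive, since \<open>s n\<close> tends to infinity.\<close>
  define U where "U n t = u (max R (s n + t))" for n t
  have U_lip: "norm (U n x - U n y) \<le> L * \<delta>0 * \<bar>x - y\<bar>" for n x y
  proof -
    have "norm (U n x - U n y) \<le> L * \<delta>0 * \<bar>max R (s n + x) - max R (s n + y)\<bar>"
      unfolding U_def by (rule lip) auto
    also have "\<dots> \<le> L * \<delta>0 * \<bar>x - y\<bar>"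
      using truncated.B_nonneg by (intro mult_left_mono) (auto simp: max_def)
    finally show ?thesis .
  qed
  have equi: "equicontinuous U"
    unfolding equicontinuous_def
  proof (intro allI impI)
    fix e :: real assume "0 < e"
    let ?K = "L * \<delta>0"
    have K: "0 < ?K" using L_pos const_pos by simp
    have "norm (U n x - U n y) < e" if "\<bar>x - y\<bar> < e / ?K" for n x y
      using le_less_trans[OF U_lip] that K by (simp add: field_simps)
    then show "\<exists>d>0. \<forall>n s t. \<bar>s - t\<bar> < d \<longrightarrow> norm (U n s - U n t) < e"
      using K \<open>0 < e\<close> by (meson divide_pos_pos)
  qed
  have "norm (U n t) \<le> \<delta>" for n t unfolding U_def using R by (intro small) auto
  then obtain p w where p: "strict_mono (p :: nat \<Rightarrow> nat)" and lim: "\<And>t. (\<lambda>n. U (p n) t) \<longlonglongrightarrow> w t"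
    using equicontinuous_convergent_subsequence[OF equi, of "\<lambda>_. \<delta>"] by blast
  have equi': "equicontinuous (\<lambda>n. U (p n))" by (rule equicontinuous_subseq[OF equi])
  have w_cont: "continuous_on S w" for S by (rule equicontinuous_limit_continuous_on[OF equi' lim])
  have sub: "\<forall>\<^sub>F n in sequentially. P (p n)" if "eventually P sequentially" for P
    using eventually_subseq[OF p that] .
  have w_le: "norm (w t) \<le> d" for t
  proof (rule field_le_epsilon)
    fix e :: real assume "0 < e"
    obtain T where T: "\<And>t. T \<le> t \<Longrightarrow> norm (u t) \<le> d + e"
      using upper[OF \<open>0 < e\<close>] unfolding eventually_at_top_linorder by blast
    have "\<forall>\<^sub>F n in sequentially. norm (U n t) \<le> d + e"
      using late[of T t] by eventually_elim (auto simp: U_def intro!: T)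
    then show "norm (w t) \<le> d + e"
      by (intro tendsto_upperbound[OF tendsto_norm[OF lim]] sub) auto
  qed
  have "d \<le> norm (w 0)"
  proof -
    have "(\<lambda>n. d - 1 / real (Suc n)) \<longlonglongrightarrow> d - 0"
      using LIMSEQ_inverse_real_of_nat by (intro tendsto_intros) (simp add: inverse_eq_divide)
    then have "(\<lambda>n. d - 1 / real (Suc (p n))) \<longlonglongrightarrow> d"
      using LIMSEQ_subseq_LIMSEQ[OF _ p] by (fastforce simp: o_def)
    moreover have ev: "\<forall>\<^sub>F n in sequentially. d - 1 / real (Suc n) \<le> norm (U n 0)"
      using late[of R 0] by eventually_elim (use s(2) in \<open>auto simp: U_def max_def intro: less_imp_le\<close>)
    ultimately show ?thesis
      by (intro tendsto_le[OF _ tendsto_norm[OF lim] _ sub[OF ev]]) simp_all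
  qed
  have int: "w y - w x = integral {x..y} (dde_rhs G \<sigma> w)" if "x \<le> y" for x y
  proof (rule truncated.integral_equation_limit[OF equi' lim, of "\<lambda>_. 0"])
    \<comment> \<open>The threshold \<open>2 * R\<close> leaves one full delay: times from
      \<open>2 * R\<close> on have deviated arguments at or above \<open>R\<close>, where
      \<open>U n\<close> is still the plain translate of \<open>u\<close>.\<close>
    have "\<forall>\<^sub>F n in sequentially. U n y - U n x = integral {x..y} (\<lambda>t. dde_rhs G \<sigma> (U n) (t - 0))"
      using late[of "2 * R" x]
    proof eventually_elim
      fix n assume n: "2 * R \<le> s n + x"
      have U_u: "U n t = u (s n + t)" if "R \<le> s n + t" for t using that by (simp add: U_def)
      have "(U n has_vector_derivative dde_rhs G \<sigma> (U n) t) (at t within {x..y})" if t: "t \<in> {x..y}" for t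
      proof -
        have t': "2 * R \<le> s n + t" using n t by simp
        have "\<sigma> (u (s n + t)) = \<tau> (u (s n + t))"
          using small0[of "s n + t"] t' R by (simp add: \<sigma>_def proj_self)
        then have "dde_rhs G \<sigma> (U n) t = dde_rhs G \<sigma> u (s n + t)"
          using U_u[of t] U_u[of "t - \<tau> (u (s n + t))"] delay[of "s n + t"] t' R
          by (simp add: dde_rhs_def add_diff_eq)
        also have "\<dots> = dde_rhs f \<tau> u (s n + t)" using t' R by (intro rhs) simp
        finally have eq: "dde_rhs G \<sigma> (U n) t = dde_rhs f \<tau> u (s n + t)" .
        have "(u has_vector_derivative dde_rhs f \<tau> u (s n + t)) (at (s n + t) within (+) (s n) ` {x..y})"
          by (rule has_vector_derivative_within_subset[OF deriv]) (use t' n R in auto)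
        then have "((\<lambda>t. u (s n + t)) has_vector_derivative dde_rhs f \<tau> u (s n + t)) (at t within {x..y})"
          by (rule has_vector_derivative_shift)
        then show ?thesis unfolding eq
          by (rule has_vector_derivative_transform[OF t, rotated]) (use n R in \<open>simp add: U_u\<close>)
      qed
      then have "(dde_rhs G \<sigma> (U n) has_integral (U n y - U n x)) {x..y}"
        by (rule fundamental_theorem_of_calculus[OF that])
      then show "U n y - U n x = integral {x..y} (\<lambda>t. dde_rhs G \<sigma> (U n) (t - 0))"
        by (simp add: integral_unique)
    qed
    from sub[OF this] show "\<forall>\<^sub>F n in sequentially.
        U (p n) y - U (p n) x = integral {x..y} (\<lambda>t. dde_rhs G \<sigma> (U (p n)) (t - 0))" .
  qed simp
  \<comment> \<open>The criterion is used at level \<open>d\<close>, which is admissible because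
    \<open>d \<le> \<delta> < \<delta>1\<close>. The limit \<open>w\<close> is defined for all times
    and bounded by \<open>d\<close>, so the whole history before time 0 is at hand.\<close>
  have "norm (w 0) \<noteq> d"
  proof (rule no_critical_orbit'[OF _ refl zero_less_one w_cont])
    show "d \<in> {0<..<\<delta>1}" using d \<delta> by simp
    fix t :: real
    let ?a = "0 - real k * r d"
    show "norm (w t) \<le> \<delta>0" using w_le[of t] d \<delta>0 by simp
    show "norm (w t) \<le> d" by (rule w_le)
    assume t: "t \<in> {?a..<1}"
    have "(w has_vector_derivative dde_rhs G \<sigma> w t) (at t within {?a..})"
    proof (rule has_vector_derivative_if_integral)
      show "continuous_on {?a..} (dde_rhs G \<sigma> w)"
        by (rule truncated.dde_rhs_continuous_on[OF w_cont[of UNIV]]) auto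
      show "w t = w ?a + integral {?a..t} (dde_rhs G \<sigma> w)" if "?a \<le> t" for t
        unfolding int[OF that, symmetric] by simp
    qed (use t in simp)
    moreover have "dde_rhs G \<sigma> w t = dde_rhs f \<tau> w t"
      using w_le d \<delta>0 by (meson dde_rhs_truncated order_trans)
    ultimately show "(w has_vector_derivative dde_rhs f \<tau> w t) (at t within {?a..<1})"
      by (auto elim!: has_vector_derivative_within_subset)
  qed
  then show False using w_le[of 0] \<open>d \<le> norm (w 0)\<close> by simp
qed

section \<open>Attractivity and the two stability statements\<close>

lemma global_solutions_tendsto_0:
  assumes \<delta>: "\<delta> \<in> {0<..<\<delta>1}" and \<phi>: "continuous_on {- R..0} \<phi>"
    and init: "\<And>s. s \<in> {- r \<delta>..0} \<Longrightarrow> norm (\<phi> s) < \<delta> * exp (- (L * real k * r \<delta>))"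
  shows "global_solutions_satisfy f \<tau> R \<phi> (\<lambda>u. (u \<longlongrightarrow> 0) at_top)"
  using global_solutions_bounded[OF assms]
  by (rule global_solutions_satisfy_mono) (auto intro: bounded_solution_tendsto_0[OF \<delta>] less_imp_le)

text \<open>The criterion is available only below \<delta>1, but the strict bound on \<phi> over a
  compact interval leaves room: the maximum of \<open>norm (\<phi> s)\<close> is attained, so some
  \<open>\<delta> < \<delta>1\<close> satisfies the same bound with the factor of \<delta>1. As
  \<open>r \<delta> \<le> r \<delta>1\<close>, the factor belonging to \<delta> is no
  smaller.\<close>

lemma global_solutions_tendsto_0':
  assumes \<phi>: "continuous_on {- R..0} \<phi>"
    and init: "\<And>s. s \<in> {- r \<delta>1..0} \<Longrightarrow> norm (\<phi> s) < \<delta>1 * exp (- (L * real k * r \<delta>1))"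
  shows "global_solutions_satisfy f \<tau> R \<phi> (\<lambda>u. (u \<longlongrightarrow> 0) at_top)"
proof -
  have r: "0 < r \<delta>1" "r \<delta>1 \<le> R" using delta1 by (auto intro: max_delay_pos max_delay_mono)
  have "continuous_on {- r \<delta>1..0} (\<lambda>s. norm (\<phi> s))"
    by (intro continuous_intros continuous_on_subset[OF \<phi>]) (use r in auto)
  then obtain s0 where s0: "s0 \<in> {- r \<delta>1..0}" "\<And>s. s \<in> {- r \<delta>1..0} \<Longrightarrow> norm (\<phi> s) \<le> norm (\<phi> s0)"
    using continuous_attains_sup[of "{- r \<delta>1..0}" "\<lambda>s. norm (\<phi> s)"] r by auto
  define E where "E = exp (- (L * real k * r \<delta>1))"
  have "norm (\<phi> s0) / E < \<delta>1" using init[OF s0(1)] by (simp add: E_def divide_less_eq)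
  then obtain \<delta> where \<delta>: "max 0 (norm (\<phi> s0) / E) < \<delta>" "\<delta> < \<delta>1"
    using dense[of "max 0 (norm (\<phi> s0) / E)" \<delta>1] delta1(1) by auto
  then have \<delta>1: "\<delta> \<in> {0<..<\<delta>1}" by simp
  have le: "r \<delta> \<le> r \<delta>1" using \<delta> by (intro max_delay_mono) auto
  show ?thesis
  proof (rule global_solutions_tendsto_0[OF \<delta>1 \<phi>])
    fix s assume "s \<in> {- r \<delta>..0}"
    then have "norm (\<phi> s) \<le> norm (\<phi> s0)" using le by (intro s0(2)) auto
    also have "norm (\<phi> s0) < \<delta> * E" using \<delta>(1) by (simp add: E_def divide_less_eq)
    also have "\<delta> * E \<le> \<delta> * exp (- (L * real k * r \<delta>))"
      unfolding E_def using \<delta> le L_pos by (intro mult_left_mono) (auto intro!: mult_left_mono)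
    finally show "norm (\<phi> s) < \<delta> * exp (- (L * real k * r \<delta>))" .
  qed
qed

lemma lyapunov_stable: "lyapunov_stable f \<tau> R"
  unfolding lyapunov_stable_def
proof (intro allI impI)
  fix \<epsilon> :: real assume "0 < \<epsilon>"
  \<comment> \<open>Halving keeps \<delta> strictly below \<delta>1 when \<epsilon> is
    large.\<close>
  define \<delta> where "\<delta> = min \<epsilon> (\<delta>1 / 2)"
  have \<delta>: "\<delta> \<in> {0<..<\<delta>1}" "\<delta> \<le> \<epsilon>" using \<open>0 < \<epsilon>\<close> delta1 by (auto simp: \<delta>_def min_def)
  have r: "r \<delta> \<le> R" using \<delta> delta1 by (intro max_delay_mono) auto
  let ?\<rho> = "\<delta> * exp (- (L * real k * r \<delta>))"
  have "global_solutions_satisfy f \<tau> R \<phi> (\<lambda>u. \<forall>t\<ge>0. norm (u t) < \<epsilon>)"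
    if "continuous_on {- R..0} \<phi>" "\<forall>s\<in>{- R..0}. norm (\<phi> s) < ?\<rho>" for \<phi>
    by (rule global_solutions_satisfy_mono[OF global_solutions_bounded[OF \<delta>(1) that(1)]])
      (use that(2) r \<delta>(2) in force)+
  moreover have "0 < ?\<rho>" using \<delta> by simp
  ultimately show "\<exists>\<rho>>0. \<forall>\<phi>. continuous_on {- R..0} \<phi> \<and> (\<forall>s\<in>{- R..0}. norm (\<phi> s) < \<rho>) \<longrightarrow>
      global_solutions_satisfy f \<tau> R \<phi> (\<lambda>u. \<forall>t\<ge>0. norm (u t) < \<epsilon>)"
    by blast
qed

lemma asymptotically_stable: "asymptotically_stable f \<tau> R"
  unfolding asymptotically_stable_def
proof (intro conjI lyapunov_stable)
  have r: "r \<delta>1 \<le> R" using delta1 by (intro max_delay_mono) auto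
  let ?\<rho> = "\<delta>1 * exp (- (L * real k * r \<delta>1))"
  have "global_solutions_satisfy f \<tau> R \<phi> (\<lambda>u. (u \<longlongrightarrow> 0) at_top)"
    if "continuous_on {- R..0} \<phi>" "\<forall>s\<in>{- R..0}. norm (\<phi> s) < ?\<rho>" for \<phi>
    by (rule global_solutions_tendsto_0'[OF that(1)]) (use that(2) r in force)
  moreover have "0 < ?\<rho>" using delta1 by simp
  ultimately show "\<exists>\<rho>>0. \<forall>\<phi>. continuous_on {- R..0} \<phi> \<and> (\<forall>s\<in>{- R..0}. norm (\<phi> s) < \<rho>) \<longrightarrow>
      global_solutions_satisfy f \<tau> R \<phi> (\<lambda>u. (u \<longlongrightarrow> 0) at_top)"
    by blast
qed

end

theorem theorem2p8:
  fixes f :: "real ^ 'd \<Rightarrow> real ^ 'd \<Rightarrow> real ^ 'd"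
    and \<tau> :: "real ^ 'd \<Rightarrow> real"
    and k :: nat
    and L0 L1 L \<delta>0 \<delta>1 :: real
  assumes "k \<ge> 1"
    and f_cont: "continuous_on UNIV (\<lambda>(u, v). f u v)"
    and tau_cont: "continuous_on UNIV \<tau>"
    and f_zero: "f 0 0 = 0"
    and tau_zero: "\<tau> 0 > 0"
    and const_pos: "L0 > 0" "L1 > 0" "\<delta>0 > 0"
    and f_lipschitz:
      "\<forall>u\<in>cball 0 \<delta>0. \<forall>v\<in>cball 0 \<delta>0. \<forall>u'\<in>cball 0 \<delta>0. \<forall>v'\<in>cball 0 \<delta>0.
         norm (f u v - f u' v') \<le> L0 * norm (u - u') + L1 * norm (v - v')"
    and L: "L = L0 + L1"
    and tau_nonneg: "\<forall>u\<in>cball 0 \<delta>0. \<tau> u \<ge> 0"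
    and tau_lipschitz: "\<exists>K. K-lipschitz_on (cball 0 \<delta>0) \<tau>"
    and f_smooth: "C_on (k - 2) UNIV (\<lambda>(u, v). f u v)"
    and tau_smooth: "C_on (k - 1) UNIV \<tau>"
    and delta1: "0 < \<delta>1" "\<delta>1 \<le> \<delta>0"
    and criterion:
      "\<forall>\<delta>\<in>{0<..<\<delta>1}. \<forall>x. norm x = \<delta> \<longrightarrow>
         (\<forall>\<eta>\<in>E_set f \<tau> (max_delay \<tau> \<delta>0) k \<delta> x. \<forall>v. aux_solution f \<tau> x \<eta> v \<longrightarrow>
            1 / \<delta> * (v 0 \<bullet> x) < \<delta>)"
  shows
    "(lyapunov_stable f \<tau> (max_delay \<tau> \<delta>0) \<and>
      (\<forall>\<delta>\<in>{0<..<\<delta>1}. \<forall>\<phi>. continuous_on {- max_delay \<tau> \<delta>0..0} \<phi> \<and>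
         (\<forall>s\<in>{- max_delay \<tau> \<delta>..0}. norm (\<phi> s) < \<delta> * exp (- (L * real k * max_delay \<tau> \<delta>))) \<longrightarrow>
         global_solutions_satisfy f \<tau> (max_delay \<tau> \<delta>0) \<phi> (\<lambda>u. \<forall>t\<ge>0. norm (u t) \<le> \<delta>))) \<and>
     asymptotically_stable f \<tau> (max_delay \<tau> \<delta>0) \<and>
     (\<forall>\<phi>. continuous_on {- max_delay \<tau> \<delta>0..0} \<phi> \<and>
        (\<forall>s\<in>{- max_delay \<tau> \<delta>1..0}. norm (\<phi> s) < \<delta>1 * exp (- (L * real k * max_delay \<tau> \<delta>1))) \<longrightarrow>
        global_solutions_satisfy f \<tau> (max_delay \<tau> \<delta>0) \<phi> (\<lambda>u. (u \<longlongrightarrow> 0) at_top))"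
proof -
  interpret stable_dde f \<tau> L0 L1 L \<delta>0 k \<delta>1
    by unfold_locales (fact assms)+
  have "global_solutions_satisfy f \<tau> R \<phi> (\<lambda>u. \<forall>t\<ge>0. norm (u t) \<le> \<delta>)"
    if "\<delta> \<in> {0<..<\<delta>1}" "continuous_on {- R..0} \<phi>"
      "\<forall>s\<in>{- r \<delta>..0}. norm (\<phi> s) < \<delta> * exp (- (L * real k * r \<delta>))" for \<delta> \<phi>
    by (rule global_solutions_satisfy_mono[OF global_solutions_bounded[OF that(1,2)]])
      (use that(3) in \<open>auto intro: less_imp_le\<close>)
  then show ?thesis
    using lyapunov_stable asymptotically_stable global_solutions_tendsto_0' by blast
qed

end
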